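(* Let $f_0,F,S,L,g,h$ be as in the context, and for $\rho_1,\rho_2>0$ let $$\tilde\mu^*(x,\lambda,t)=h(x,\lambda,t)\,\phi_1\bigl(S(x,t)\bigr)\,\phi_2\bigl(S^{(1)}_o(x,\lambda,t)\bigr),$$ where $$\phi_1(s)=\frac{e^2+1}{2e^2}\left(1+\tanh\frac{s+\rho_1}{\rho_1}\right),\qquad \phi_2(s)=\begin{cases}1,& s>0,\\ \exp\left[\frac{1}{\rho_2^2}\left(1-\frac{1}{1-s^2}\right)\right],& s\in(-1,0],\\ 0,& s\le -1.\end{cases}$$ Then the following hold. (1) $\tilde\mu^*$ is continuously differentiable over an optimal trajectory (of the smoothed problem defined in the context), including at corners; i.e. $t\mapsto\tilde\mu^*(x(t),\lambda(t),t)$ is continuously differentiable. (2) $\tilde\mu^*$ respects the inequality constraint regardless of the values of $\rho_1$ and $\rho_2$; i.e. for all $\rho_1,\rho_2>0$, a trajectory of the smoothed problem, driven by the control $\tilde u^*=g(x,\lambda+\tilde\mu^*S_x^\top,t)$ and starting with $S(x(0),0)\le 0$, satisfies $S(x(t),t)\le 0$ for all $t\in[0,T]$. (3) $\tilde\mu^*$ approaches $\mu^*$ as $\rho_1,\rho_2\to+0$; i.e. for each $(x,\lambda,t)$ with $S(x,t)\le 0$, $\tilde\mu^*(x,\lambda,t)\to\mu^*(x,\lambda,t)$, where $$\mu^*(x,\lambda,t)=\begin{cases}h(x,\lambda,t),& \text{if } S(x,t)=0 \text{ and } S^{(1)}_o(x,\lambda,t)\ge 0,\\ 0,&\text{ot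herwise.}\end{cases}$$
   Context: Setting: the control-affine system $\dot x=f(x,u,t)=f_0(x,t)+F(x,t)u$ with state $x\in\mathbb{R}^n$, control $u\in\mathbb{R}^m$, time $t\in[0,T]$; running cost $L(x,u,t)\in\mathbb{R}$, total cost $\int_0^T L\,dt$; scalar state constraint $S(x,t)\le 0$; costate $\lambda\in\mathbb{R}^n$; constraint multiplier $\mu\in\mathbb{R}$. Notation: $S_x=\nabla_x S\in\mathbb{R}^{1\times n}$, $S_t=\partial S/\partial t$, and $$S^{(1)}(x,u,t)=S_x f_0+S_xFu+S_t,\qquad H_o(x,u,\lambda,t)=L(x,u,t)+\lambda^\top[f_0(x,t)+F(x,t)u],$$ $$H(x,u,\lambda,\mu,t)=L(x,u,t)+\lambda^\top[f_0(x,t)+F(x,t)u]+\mu S^{(1)}(x,u,t).$$ Standing assumptions: (i) $F$ and $S$ are twice continuously differentiable, and $f_0$ is twice (continuously) differentiable. (ii) $S_x(x,t)F(x,t)\ne 0$ for all $x,t$ (first-order constraint). (iii) For all $(x,\lambda,t)$, $\min_{u\in\mathbb{R}^m}H_o(x,u,\lambda,t)$ has a unique solution $u_o^*=g(x,\lambda,t)$, where $g$ is continuously differentiable, $L$ is twice continuously differentiable in $u$, and at $u=g(x,\lambda,t)$ one has $\nabla_uL(x,u,t)+\lambda^\top F(x,t)=0$ and $\nabla^2_{uu}L(x,u,t)\succ0$. Unconstrained derivative: $S^{(1)}_o(x,\lambda,t)=S^{(1)}(x,g(x,\lambda,t),t)$. The function $h$: $h(x,\lambda,t)$ is the unique real $\mu$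 solving $S^{(1)}\bigl(x,g(x,\lambda+\mu S_x^\top,t),t\bigr)=0$; under the assumptions above $h$ is a continuously differentiable function of $(x,\lambda,t)$, and $h\ge 0$ where $S^{(1)}_o\ge 0$. Constrained and unconstrained arcs: a point is on an unconstrained arc if $S<0$, on a constrained arc if $S=0$ and $S_o^{(1)}\ge 0$, and infeasible if $S>0$. A corner is a time of entry to a constrained arc. Trajectory of the smoothed problem: for given $\rho_1,\rho_2,\rho_3>0$, a pair of continuously differentiable functions $(x(t),\lambda(t))$ on $[0,T]$ satisfying $$\dot x=f_0(x,t)+F(x,t)\tilde u^*,\qquad \dot\lambda=-[\nabla_xH(x,\tilde u^*,\lambda,\tilde\mu^*,t)]^\top-2h(x,\lambda,t)\,\tilde\delta(S)\,S^{(1)}(x,\tilde u^*,t)\,S_x^\top,$$ where $\tilde u^*=g(x,\lambda+\tilde\mu^*S_x^\top,t)$, $\tilde\mu^*=\tilde\mu^*(x,\lambda,t)$, $\nabla_xH$ is the partial gradient in $x$ with $u,\lambda,\mu$ held fixed, and $\tilde\delta(s)=\frac{1}{\rho_3\sqrt{2\pi}}\exp\left(-\frac{s^2}{2\rho_3^2}\right)$. An optimal trajectory of the smoothed problem is such a trajectory that in addition satisfies the boundary/transversality conditions of the problem. *)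

theory Defs
  imports "HOL-Analysis.Analysis"
begin

text \<open>
  Derivatives are taken within the set, so that functions of time are only looked at on the
  horizon \<open>[0,T]\<close> (one-sidedly at its end points).  On the sets used below, \<open>[0,T]\<close> and its
  products with Euclidean spaces for \<open>T > 0\<close>, these derivatives are unique.
\<close>

definition C1_on :: "'a::real_normed_vector set \<Rightarrow> ('a \<Rightarrow> 'b::real_normed_vector) \<Rightarrow> bool" where
  "C1_on A f \<longleftrightarrow> (\<exists>f'. (\<forall>p\<in>A. (f has_derivative blinfun_apply (f' p)) (at p within A)) \<and>
                     continuous_on A f')"

definition C2_on :: "'a::real_normed_vector set \<Rightarrow> ('a \<Rightarrow> 'b::real_normed_vector) \<Rightarrow> bool" where
  "C2_on A f \<longleftrightarrow> (\<exists>f'. (\<forall>p\<in>A. (f has_derivative blinfun_apply (f' p)) (at p within A)) \<and>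
                     C1_on A f')"

definition twice_differentiable_on ::
  "('a::real_normed_vector \<Rightarrow> 'b::real_normed_vector) \<Rightarrow> 'a set \<Rightarrow> bool" where
  "twice_differentiable_on f A \<longleftrightarrow>
     (\<exists>f'. (\<forall>p\<in>A. (f has_derivative blinfun_apply (f' p)) (at p within A)) \<and>
           f' differentiable_on A)"

definition grad :: "('a::real_inner \<Rightarrow> real) \<Rightarrow> 'a \<Rightarrow> 'a" where
  "grad f x = (THE D. GDERIV f x :> D)"

definition hessian :: "(real ^ 'k \<Rightarrow> real) \<Rightarrow> real ^ 'k \<Rightarrow> real ^ 'k ^ 'k" where
  "hessian f x = jacobian (grad f) (at x)"

definition pos_def :: "real ^ 'k ^ 'k \<Rightarrow> bool" where
  "pos_def A \<longleftrightarrow> transpose A = A \<and> (\<forall>v. v \<noteq> 0 \<longrightarrow> v \<bullet> (A *v v) > 0)"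

text \<open>
  The problem data are \<open>T\<close>, \<open>f0 x t\<close>, \<open>F x t\<close>, \<open>S x t\<close>, \<open>L x u t\<close>, and the unconstrained minimiser
  \<open>g x \<lambda> t\<close>.  Row vectors such as the gradient of \<open>S\<close> in \<open>x\<close> are represented by the
  corresponding elements of \<open>real ^ 'n\<close>, and products of rows with columns by \<open>\<bullet>\<close>.
\<close>

definition S_x :: "(real ^ 'n \<Rightarrow> real \<Rightarrow> real) \<Rightarrow> real ^ 'n \<Rightarrow> real \<Rightarrow> real ^ 'n" where
  "S_x S x t = grad (\<lambda>y. S y t) x"

definition S_t :: "real \<Rightarrow> (real ^ 'n \<Rightarrow> real \<Rightarrow> real) \<Rightarrow> real ^ 'n \<Rightarrow> real \<Rightarrow> real" where
  "S_t T S x t = vector_derivative (\<lambda>s. S x s) (at t within {0..T})"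

definition S1 ::
  "real \<Rightarrow> (real ^ 'n \<Rightarrow> real \<Rightarrow> real ^ 'n) \<Rightarrow> (real ^ 'n \<Rightarrow> real \<Rightarrow> real ^ 'm ^ 'n) \<Rightarrow>
   (real ^ 'n \<Rightarrow> real \<Rightarrow> real) \<Rightarrow> real ^ 'n \<Rightarrow> real ^ 'm \<Rightarrow> real \<Rightarrow> real" where
  "S1 T f0 F S x u t = S_x S x t \<bullet> f0 x t + S_x S x t \<bullet> (F x t *v u) + S_t T S x t"

definition H_o ::
  "(real ^ 'n \<Rightarrow> real \<Rightarrow> real ^ 'n) \<Rightarrow> (real ^ 'n \<Rightarrow> real \<Rightarrow> real ^ 'm ^ 'n) \<Rightarrow>
   (real ^ 'n \<Rightarrow> real ^ 'm \<Rightarrow> real \<Rightarrow> real) \<Rightarrow> real ^ 'n \<Rightarrow> real ^ 'm \<Rightarrow> real ^ 'n \<Rightarrow> real \<Rightarrow> real" where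
  "H_o f0 F L x u lam t = L x u t + lam \<bullet> (f0 x t + F x t *v u)"

definition H ::
  "real \<Rightarrow> (real ^ 'n \<Rightarrow> real \<Rightarrow> real ^ 'n) \<Rightarrow> (real ^ 'n \<Rightarrow> real \<Rightarrow> real ^ 'm ^ 'n) \<Rightarrow>
   (real ^ 'n \<Rightarrow> real \<Rightarrow> real) \<Rightarrow> (real ^ 'n \<Rightarrow> real ^ 'm \<Rightarrow> real \<Rightarrow> real) \<Rightarrow>
   real ^ 'n \<Rightarrow> real ^ 'm \<Rightarrow> real ^ 'n \<Rightarrow> real \<Rightarrow> real \<Rightarrow> real" where
  "H T f0 F S L x u lam mu t =
     L x u t + lam \<bullet> (f0 x t + F x t *v u) + mu * S1 T f0 F S x u t"

definition S1_o ::
  "real \<Rightarrow> (real ^ 'n \<Rightarrow> real \<Rightarrow> real ^ 'n) \<Rightarrow> (real ^ 'n \<Rightarrow> real \<Rightarrow> real ^ 'm ^ 'n) \<Rightarrow>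
   (real ^ 'n \<Rightarrow> real \<Rightarrow> real) \<Rightarrow> (real ^ 'n \<Rightarrow> real ^ 'n \<Rightarrow> real \<Rightarrow> real ^ 'm) \<Rightarrow>
   real ^ 'n \<Rightarrow> real ^ 'n \<Rightarrow> real \<Rightarrow> real" where
  "S1_o T f0 F S g x lam t = S1 T f0 F S x (g x lam t) t"

definition h ::
  "real \<Rightarrow> (real ^ 'n \<Rightarrow> real \<Rightarrow> real ^ 'n) \<Rightarrow> (real ^ 'n \<Rightarrow> real \<Rightarrow> real ^ 'm ^ 'n) \<Rightarrow>
   (real ^ 'n \<Rightarrow> real \<Rightarrow> real) \<Rightarrow> (real ^ 'n \<Rightarrow> real ^ 'n \<Rightarrow> real \<Rightarrow> real ^ 'm) \<Rightarrow>
   real ^ 'n \<Rightarrow> real ^ 'n \<Rightarrow> real \<Rightarrow> real" where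
  "h T f0 F S g x lam t =
     (THE mu. S1 T f0 F S x (g x (lam + mu *\<^sub>R S_x S x t) t) t = 0)"

definition phi1 :: "real \<Rightarrow> real \<Rightarrow> real" where
  "phi1 rho1 s = ((exp 1)\<^sup>2 + 1) / (2 * (exp 1)\<^sup>2) * (1 + tanh ((s + rho1) / rho1))"

definition phi2 :: "real \<Rightarrow> real \<Rightarrow> real" where
  "phi2 rho2 s =
     (if s > 0 then 1
      else if s > -1 then exp (1 / rho2\<^sup>2 * (1 - 1 / (1 - s\<^sup>2)))
      else 0)"

definition mu_smooth ::
  "real \<Rightarrow> (real ^ 'n \<Rightarrow> real \<Rightarrow> real ^ 'n) \<Rightarrow> (real ^ 'n \<Rightarrow> real \<Rightarrow> real ^ 'm ^ 'n) \<Rightarrow>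
   (real ^ 'n \<Rightarrow> real \<Rightarrow> real) \<Rightarrow> (real ^ 'n \<Rightarrow> real ^ 'n \<Rightarrow> real \<Rightarrow> real ^ 'm) \<Rightarrow>
   real \<Rightarrow> real \<Rightarrow> real ^ 'n \<Rightarrow> real ^ 'n \<Rightarrow> real \<Rightarrow> real" where
  "mu_smooth T f0 F S g rho1 rho2 x lam t =
     h T f0 F S g x lam t * phi1 rho1 (S x t) * phi2 rho2 (S1_o T f0 F S g x lam t)"

definition mu_star ::
  "real \<Rightarrow> (real ^ 'n \<Rightarrow> real \<Rightarrow> real ^ 'n) \<Rightarrow> (real ^ 'n \<Rightarrow> real \<Rightarrow> real ^ 'm ^ 'n) \<Rightarrow>
   (real ^ 'n \<Rightarrow> real \<Rightarrow> real) \<Rightarrow> (real ^ 'n \<Rightarrow> real ^ 'n \<Rightarrow> real \<Rightarrow> real ^ 'm) \<Rightarrow>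
   real ^ 'n \<Rightarrow> real ^ 'n \<Rightarrow> real \<Rightarrow> real" where
  "mu_star T f0 F S g x lam t =
     (if S x t = 0 \<and> S1_o T f0 F S g x lam t \<ge> 0 then h T f0 F S g x lam t else 0)"

definition u_smooth ::
  "real \<Rightarrow> (real ^ 'n \<Rightarrow> real \<Rightarrow> real ^ 'n) \<Rightarrow> (real ^ 'n \<Rightarrow> real \<Rightarrow> real ^ 'm ^ 'n) \<Rightarrow>
   (real ^ 'n \<Rightarrow> real \<Rightarrow> real) \<Rightarrow> (real ^ 'n \<Rightarrow> real ^ 'n \<Rightarrow> real \<Rightarrow> real ^ 'm) \<Rightarrow>
   real \<Rightarrow> real \<Rightarrow> real ^ 'n \<Rightarrow> real ^ 'n \<Rightarrow> real \<Rightarrow> real ^ 'm" where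
  "u_smooth T f0 F S g rho1 rho2 x lam t =
     g x (lam + mu_smooth T f0 F S g rho1 rho2 x lam t *\<^sub>R S_x S x t) t"

definition delta_smooth :: "real \<Rightarrow> real \<Rightarrow> real" where
  "delta_smooth rho3 s = 1 / (rho3 * sqrt (2 * pi)) * exp (- s\<^sup>2 / (2 * rho3\<^sup>2))"

text \<open>
  The gradient \<open>p\<close> of \<open>H\<close> in \<open>x\<close> is taken with \<open>u\<close>, \<open>\<lambda>\<close>, \<open>\<mu>\<close> frozen at their current values.  Its
  existence along the trajectory, i.e. differentiability of \<open>L\<close> in \<open>x\<close> there, is part of
  what it means to satisfy the costate equation.
\<close>

definition smoothed_trajectory ::
  "real \<Rightarrow> (real ^ 'n \<Rightarrow> real \<Rightarrow> real ^ 'n) \<Rightarrow> (real ^ 'n \<Rightarrow> real \<Rightarrow> real ^ 'm ^ 'n) \<Rightarrow>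
   (real ^ 'n \<Rightarrow> real \<Rightarrow> real) \<Rightarrow> (real ^ 'n \<Rightarrow> real ^ 'm \<Rightarrow> real \<Rightarrow> real) \<Rightarrow>
   (real ^ 'n \<Rightarrow> real ^ 'n \<Rightarrow> real \<Rightarrow> real ^ 'm) \<Rightarrow> real \<Rightarrow> real \<Rightarrow> real \<Rightarrow>
   (real \<Rightarrow> real ^ 'n) \<Rightarrow> (real \<Rightarrow> real ^ 'n) \<Rightarrow> bool" where
  "smoothed_trajectory T f0 F S L g rho1 rho2 rho3 x lam \<longleftrightarrow>
     C1_on {0..T} x \<and> C1_on {0..T} lam \<and>
     (\<forall>t\<in>{0..T}.
        let u = u_smooth T f0 F S g rho1 rho2 (x t) (lam t) t;
            mu = mu_smooth T f0 F S g rho1 rho2 (x t) (lam t) t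
        in (x has_vector_derivative f0 (x t) t + F (x t) t *v u) (at t within {0..T}) \<and>
           (\<exists>p. (GDERIV (\<lambda>y. H T f0 F S L y u (lam t) mu t) (x t) :> p) \<and>
                (lam has_vector_derivative
                   - p - (2 * h T f0 F S g (x t) (lam t) t * delta_smooth rho3 (S (x t) t)
                            * S1 T f0 F S (x t) u t) *\<^sub>R S_x S (x t) t)
                  (at t within {0..T})))"

text \<open>
  \<open>BC\<close> stands for the boundary and transversality conditions of the problem at hand, as a
  relation between \<open>x 0\<close>, \<open>\<lambda> 0\<close>, \<open>x T\<close> and \<open>\<lambda> T\<close>.
\<close>

definition smoothed_optimal_trajectory ::
  "(real ^ 'n \<Rightarrow> real ^ 'n \<Rightarrow> real ^ 'n \<Rightarrow> real ^ 'n \<Rightarrow> bool) \<Rightarrow>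
   real \<Rightarrow> (real ^ 'n \<Rightarrow> real \<Rightarrow> real ^ 'n) \<Rightarrow> (real ^ 'n \<Rightarrow> real \<Rightarrow> real ^ 'm ^ 'n) \<Rightarrow>
   (real ^ 'n \<Rightarrow> real \<Rightarrow> real) \<Rightarrow> (real ^ 'n \<Rightarrow> real ^ 'm \<Rightarrow> real \<Rightarrow> real) \<Rightarrow>
   (real ^ 'n \<Rightarrow> real ^ 'n \<Rightarrow> real \<Rightarrow> real ^ 'm) \<Rightarrow> real \<Rightarrow> real \<Rightarrow> real \<Rightarrow>
   (real \<Rightarrow> real ^ 'n) \<Rightarrow> (real \<Rightarrow> real ^ 'n) \<Rightarrow> bool" where
  "smoothed_optimal_trajectory BC T f0 F S L g rho1 rho2 rho3 x lam \<longleftrightarrow>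
     smoothed_trajectory T f0 F S L g rho1 rho2 rho3 x lam \<and> BC (x 0) (lam 0) (x T) (lam T)"

end

theory Submission
  imports Defs "HOL-Real_Asymp.Real_Asymp"
begin

text \<open>
  Since \<open>g x (\<lambda> + \<mu> S_x) t\<close> minimises a cost plus the linear term \<open>\<mu> (S_x F) u\<close>, the constraint
  rate \<open>S1\<close> along it attains every value as \<open>\<mu>\<close> varies (compare with a competitor \<open>u\<close> of smaller
  \<open>(S_x F) u\<close>), and by positivity of the Hessian it has negative derivative in \<open>\<mu>\<close>.  Hence \<open>h\<close> is
  well defined, and the implicit function theorem along a trajectory makes it \<open>C1\<close> in time, which
  gives (1) because \<open>phi1\<close> and \<open>phi2\<close> are \<open>C1\<close>.

  For (2), the multiplier \<open>h * phi2\<close> is never below \<open>h\<close>: where \<open>phi2 < 1\<close> one has \<open>S1_o < 0\<close>, so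
  \<open>h < 0\<close>.  It therefore makes \<open>S1\<close> nonpositive.  The remaining factor satisfies
  \<open>phi1 0 = 1\<close> and is Lipschitz, so the actual rate obeys \<open>d/dt S \<le> C \<bar>S\<bar>\<close> along the trajectory, and
  \<open>S\<close> cannot become positive.  For \<open>S > 0\<close> the rate itself may be positive, so no pointwise sign
  argument is available.
\<close>


subsection \<open>Continuously differentiable maps on a set\<close>

text \<open>On a Euclidean domain, continuity of the derivative in operator norm follows from
  continuity of its values on basis vectors. The closure rules below therefore use plain functions
  \<open>D p\<close> and check one direction at a time.\<close>

lemma C1_onI:
  fixes f :: "'a::euclidean_space \<Rightarrow> 'b::real_normed_vector"
  assumes der: "\<And>p. p \<in> A \<Longrightarrow> (f has_derivative D p) (at p within A)"
    and cont: "\<And>i. i \<in> Basis \<Longrightarrow> continuous_on A (\<lambda>p. D p i)"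
  shows "C1_on A f"
proof -
  have D: "blinfun_apply (Blinfun (D p)) = D p" if "p \<in> A" for p
    using der[OF that] by (simp add: bounded_linear_Blinfun_apply has_derivative_bounded_linear)
  have "continuous_on A (\<lambda>p. Blinfun (D p))"
  proof (rule continuous_on_blinfun_componentwise)
    fix i :: 'a assume "i \<in> Basis"
    then show "continuous_on A (\<lambda>p. blinfun_apply (Blinfun (D p)) i)"
      using cont D by (metis (mono_tags, lifting) continuous_on_cong)
  qed
  moreover have "\<forall>p\<in>A. (f has_derivative blinfun_apply (Blinfun (D p))) (at p within A)"
    using der D by simp
  ultimately show ?thesis
    unfolding C1_on_def by (intro exI[of _ "\<lambda>p. Blinfun (D p)"] conjI)
qed

lemma C1_onE:
  assumes "C1_on A f"
  obtains f' where "\<forall>p\<in>A. (f has_derivative blinfun_apply (f' p)) (at p within A)"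
    and "continuous_on A f'" and "\<forall>v. continuous_on A (\<lambda>p. blinfun_apply (f' p) v)"
proof -
  obtain f' where f': "\<forall>p\<in>A. (f has_derivative blinfun_apply (f' p)) (at p within A)"
      "continuous_on A f'"
    using assms unfolding C1_on_def by blast
  have "\<forall>v. continuous_on A (\<lambda>p. blinfun_apply (f' p) v)"
    by (intro allI continuous_intros f'(2))
  with f' show thesis by (rule that)
qed

lemma C1_on_imp_continuous_on: "C1_on A f \<Longrightarrow> continuous_on A f"
  unfolding C1_on_def
  by (auto simp: continuous_on_eq_continuous_within intro: has_derivative_continuous)

lemma C1_on_compose:
  assumes f: "C1_on A f" and k: "C1_on B k" and sub: "f ` A \<subseteq> B"
  shows "C1_on A (\<lambda>p. k (f p))"
proof -
  obtain f' where f': "\<forall>p\<in>A. (f has_derivative blinfun_apply (f' p)) (at p within A)"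
    "continuous_on A f'" using f unfolding C1_on_def by blast
  obtain k' where k': "\<forall>p\<in>B. (k has_derivative blinfun_apply (k' p)) (at p within B)"
    "continuous_on B k'" using k unfolding C1_on_def by blast
  have "((\<lambda>p. k (f p)) has_derivative blinfun_apply (k' (f p) o\<^sub>L f' p)) (at p within A)"
    if "p \<in> A" for p
    using has_derivative_in_compose2[OF k'(1)[rule_format] sub that f'(1)[rule_format, OF that]]
    by (simp add: blinfun_compose.rep_eq o_def)
  moreover have "continuous_on A (\<lambda>p. k' (f p) o\<^sub>L f' p)"
    by (intro continuous_intros f'(2) continuous_on_compose2[OF k'(2)] C1_on_imp_continuous_on f sub)
  ultimately show ?thesis
    unfolding C1_on_def by (intro exI[of _ "\<lambda>p. k' (f p) o\<^sub>L f' p"] conjI ballI)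
qed

lemma C1_on_bounded_linear:
  fixes f :: "'a::euclidean_space \<Rightarrow> 'b::real_normed_vector"
  assumes "bounded_linear f"
  shows "C1_on A f"
  by (rule C1_onI[where D = "\<lambda>_. f"]) (auto intro: bounded_linear_imp_has_derivative assms)

lemma C1_on_bounded_linear_compose:
  fixes f :: "'a::euclidean_space \<Rightarrow> 'b::real_normed_vector"
  assumes k: "bounded_linear k" and f: "C1_on A f"
  shows "C1_on A (\<lambda>p. k (f p))"
proof (rule C1_onE[OF f])
  fix f' assume f': "\<forall>p\<in>A. (f has_derivative blinfun_apply (f' p)) (at p within A)"
    "\<forall>v. continuous_on A (\<lambda>p. blinfun_apply (f' p) v)"
  show ?thesis
    by (rule C1_onI[where D = "\<lambda>p v. k (f' p v)"])
      (auto intro!: bounded_linear.has_derivative[OF k] f'[rule_format] bounded_linear.continuous_on[OF k])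
qed

lemma C1_on_bounded_bilinear:
  fixes f :: "'a::euclidean_space \<Rightarrow> 'b::real_normed_vector"
  assumes pr: "bounded_bilinear pr" and f: "C1_on A f" and k: "C1_on A k"
  shows "C1_on A (\<lambda>p. pr (f p) (k p))"
proof (rule C1_onE[OF f], rule C1_onE[OF k])
  have f_cont: "continuous_on A f" and k_cont: "continuous_on A k"
    using f k by (auto intro: C1_on_imp_continuous_on)
  fix f' k'
  assume f': "\<forall>p\<in>A. (f has_derivative blinfun_apply (f' p)) (at p within A)"
    "\<forall>v. continuous_on A (\<lambda>p. blinfun_apply (f' p) v)"
    and k': "\<forall>p\<in>A. (k has_derivative blinfun_apply (k' p)) (at p within A)"
    "\<forall>v. continuous_on A (\<lambda>p. blinfun_apply (k' p) v)"
  show ?thesis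
    by (rule C1_onI[where D = "\<lambda>p v. pr (f p) (k' p v) + pr (f' p v) (k p)"])
      (auto intro!: bounded_bilinear.FDERIV[OF pr] f'[rule_format] k'[rule_format] continuous_on_add
        bounded_bilinear.continuous_on[OF pr] f_cont k_cont)
qed

lemmas C1_on_inner = C1_on_bounded_bilinear[OF bounded_bilinear_inner]
lemmas C1_on_scaleR = C1_on_bounded_bilinear[OF bounded_bilinear_scaleR]
lemmas C1_on_mult = C1_on_bounded_bilinear[OF bounded_bilinear_mult]

lemma bounded_bilinear_matrix_vector_mult:
  "bounded_bilinear (\<lambda>(M :: real ^ 'n ^ 'm) v. M *v v)"
  unfolding bilinear_conv_bounded_bilinear[symmetric] bilinear_def
  by (auto intro!: linearI simp: matrix_vector_right_distrib matrix_vector_mult_scaleR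
      matrix_vector_mult_add_rdistrib simp flip: scaleR_matrix_vector_assoc)

lemmas C1_on_matrix_vector_mult = C1_on_bounded_bilinear[OF bounded_bilinear_matrix_vector_mult]

lemma C1_on_add:
  fixes f :: "'a::euclidean_space \<Rightarrow> 'b::real_normed_vector"
  assumes f: "C1_on A f" and k: "C1_on A k"
  shows "C1_on A (\<lambda>p. f p + k p)"
proof (rule C1_onE[OF f], rule C1_onE[OF k])
  fix f' k'
  assume f': "\<forall>p\<in>A. (f has_derivative blinfun_apply (f' p)) (at p within A)"
    "\<forall>v. continuous_on A (\<lambda>p. blinfun_apply (f' p) v)"
    and k': "\<forall>p\<in>A. (k has_derivative blinfun_apply (k' p)) (at p within A)"
    "\<forall>v. continuous_on A (\<lambda>p. blinfun_apply (k' p) v)"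
  show ?thesis
    by (rule C1_onI[where D = "\<lambda>p v. f' p v + k' p v"])
      (auto intro!: has_derivative_add f'[rule_format] k'[rule_format] continuous_on_add)
qed

lemma C1_on_sum:
  fixes f :: "'i \<Rightarrow> 'a::euclidean_space \<Rightarrow> 'b::real_normed_vector"
  assumes "\<And>i. i \<in> I \<Longrightarrow> C1_on A (f i)"
  shows "C1_on A (\<lambda>p. \<Sum>i\<in>I. f i p)"
  using assms
proof (induction I rule: infinite_finite_induct)
  case (insert i I)
  then show ?case by (simp add: C1_on_add)
qed (simp_all add: C1_on_bounded_linear)

lemma C1_on_Pair:
  fixes f :: "'a::euclidean_space \<Rightarrow> 'b::real_normed_vector"
  assumes f: "C1_on A f" and k: "C1_on A k"
  shows "C1_on A (\<lambda>p. (f p, k p))"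
proof (rule C1_onE[OF f], rule C1_onE[OF k])
  fix f' k'
  assume f': "\<forall>p\<in>A. (f has_derivative blinfun_apply (f' p)) (at p within A)"
    "\<forall>v. continuous_on A (\<lambda>p. blinfun_apply (f' p) v)"
    and k': "\<forall>p\<in>A. (k has_derivative blinfun_apply (k' p)) (at p within A)"
    "\<forall>v. continuous_on A (\<lambda>p. blinfun_apply (k' p) v)"
  show ?thesis
    by (rule C1_onI[where D = "\<lambda>p v. (f' p v, k' p v)"])
      (auto intro!: has_derivative_Pair f'[rule_format] k'[rule_format] continuous_on_Pair)
qed

lemma C2_on_imp_C1_on: "C2_on A f \<Longrightarrow> C1_on A f"
  unfolding C2_on_def C1_on_def[of A f] by (auto dest: C1_on_imp_continuous_on)

text \<open>The first derivative is itself differentiable, hence continuous. This puts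
  \<open>f0\<close> on the same footing as \<open>F\<close> and \<open>S\<close>.\<close>

lemma twice_differentiable_on_imp_C1_on: "twice_differentiable_on f A \<Longrightarrow> C1_on A f"
  unfolding twice_differentiable_on_def C1_on_def
  by (auto dest: differentiable_imp_continuous_on)

lemma C1_on_DERIV:
  fixes f :: "real \<Rightarrow> real"
  assumes "\<And>x. (f has_real_derivative f' x) (at x)" "continuous_on UNIV f'"
  shows "C1_on UNIV f"
  using assms by (intro C1_onI[where D = "\<lambda>x. (*) (f' x)"]) (auto simp: has_field_derivative_def)

lemma C1_on_cong:
  assumes "C1_on A f" and eq: "\<And>p. p \<in> A \<Longrightarrow> k p = f p"
  shows "C1_on A k"
proof -
  obtain f' where f': "\<forall>p\<in>A. (f has_derivative blinfun_apply (f' p)) (at p within A)"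
    "continuous_on A f'" using assms(1) unfolding C1_on_def by blast
  have "(k has_derivative blinfun_apply (f' p)) (at p within A)" if "p \<in> A" for p
    by (rule has_derivative_transform[OF that eq f'(1)[rule_format, OF that]])
  with f'(2) show ?thesis
    unfolding C1_on_def by blast
qed

lemma C1_on_const:
  fixes c :: "'b::real_normed_vector"
  shows "C1_on A (\<lambda>_ :: 'a::euclidean_space. c)"
  by (rule C1_onI[where D = "\<lambda>_ _. 0"]) auto

text \<open>The derivative is bounded on the compact set \<open>B\<close>, and the mean value
  inequality along segments of the convex set turns that bound into \<open>K\<close>.\<close>

lemma C1_on_lipschitz:
  assumes f: "C1_on A f" and B: "compact B" "convex B" "B \<subseteq> A"
  obtains K where "K \<ge> 0" "\<And>p q. p \<in> B \<Longrightarrow> q \<in> B \<Longrightarrow> norm (f p - f q) \<le> K * norm (p - q)"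
proof -
  obtain f' where f': "\<forall>p\<in>A. (f has_derivative blinfun_apply (f' p)) (at p within A)"
    "continuous_on A f'" using f unfolding C1_on_def by blast
  have "bounded (f' ` B)"
    using f'(2) B by (intro compact_imp_bounded compact_continuous_image) (auto intro: continuous_on_subset)
  then obtain K where K: "K > 0" "\<forall>p\<in>B. norm (f' p) \<le> K"
    by (auto simp: bounded_pos)
  have "norm (f p - f q) \<le> K * norm (p - q)" if "p \<in> B" "q \<in> B" for p q
  proof (rule differentiable_bound[OF B(2) _ _ that])
    fix r assume "r \<in> B"
    then show "(f has_derivative blinfun_apply (f' r)) (at r within B)"
      using f'(1) B(3) by (auto intro: has_derivative_subset)
    show "onorm (blinfun_apply (f' r)) \<le> K"
      using K(2) \<open>r \<in> B\<close> by (simp add: norm_blinfun.rep_eq)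
  qed
  with K(1) show thesis by (intro that[of K]) auto
qed

text \<open>The data are curried in state and time; this is the chain rule for evaluating them along
  a path whose times stay in the horizon.\<close>

lemma C1_on_along:
  fixes y :: "'c::euclidean_space \<Rightarrow> 'a::euclidean_space" and \<tau> :: "'c \<Rightarrow> real"
  assumes "C1_on (UNIV \<times> I) (\<lambda>(x, t). k x t)" "C1_on A y" "C1_on A \<tau>" "\<tau> ` A \<subseteq> I"
  shows "C1_on A (\<lambda>p. k (y p) (\<tau> p))"
  using C1_on_compose[OF C1_on_Pair[OF assms(2,3)] assms(1)] assms(4) by auto

subsection \<open>Scalar implicit functions\<close>

text \<open>A negative derivative at every \<open>m\<close> makes each zero unique, so no branch has
  to be chosen. Continuity of \<open>z\<close> comes from the sign change of \<open>G\<close> across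
  its zero, and linearising \<open>G\<close> on the graph then yields the derivative
  \<open>- e / d\<close>. Working within \<open>A\<close> covers the end points of the
  horizon.\<close>

lemma C1_on_implicit:
  fixes G :: "real \<times> 'a::euclidean_space \<Rightarrow> real"
  assumes G: "C1_on (UNIV \<times> A) G"
    and neg: "\<And>m t. t \<in> A \<Longrightarrow> \<exists>d<0. ((\<lambda>m. G (m, t)) has_real_derivative d) (at m)"
    and zero: "\<And>t. t \<in> A \<Longrightarrow> G (z t, t) = 0"
  shows "C1_on A z"
proof -
  obtain G' where G': "\<forall>p\<in>UNIV \<times> A.
      (G has_derivative blinfun_apply (G' p)) (at p within UNIV \<times> A)"
    "continuous_on (UNIV \<times> A) G'" "\<forall>v. continuous_on (UNIV \<times> A) (\<lambda>p. blinfun_apply (G' p) v)"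
    using G by (rule C1_onE)
  define d where "d p = blinfun_apply (G' p) (1, 0)" for p
  define e where "e p v = blinfun_apply (G' p) (0, v)" for p v
  \<comment> \<open>Splits the joint derivative into the partial \<open>d\<close> in the scalar
    unknown and the partial \<open>e\<close> in the parameter.\<close>
  have G'_eq: "blinfun_apply (G' p) (m, v) = d p * m + e p v" for p m v
  proof -
    have "blinfun_apply (G' p) (m, v) = blinfun_apply (G' p) (m *\<^sub>R (1, 0) + (0, v))"
      by simp
    also have "\<dots> = m *\<^sub>R d p + e p v"
      unfolding blinfun.add_right blinfun.scaleR_right d_def e_def ..
    finally show ?thesis by simp
  qed
  have d: "((\<lambda>m. G (m, t)) has_real_derivative d (m, t)) (at m)" if "t \<in> A" for m t
  proof -
    have "((\<lambda>m. G (m, t)) has_derivative (\<lambda>h. blinfun_apply (G' (m, t)) (h, 0))) (at m)"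
      by (rule has_derivative_in_compose2[where g = G and t = "UNIV \<times> A" and s = UNIV])
        (use that in \<open>auto intro!: G'[rule_format] derivative_eq_intros\<close>)
    moreover have "(\<lambda>h. blinfun_apply (G' (m, t)) (h, 0)) = (*) (d (m, t))"
      by (rule ext) (simp add: G'_eq, simp add: e_def flip: zero_prod_def)
    ultimately show ?thesis
      by (simp add: has_field_derivative_def)
  qed
  have d_neg: "d (m, t) < 0" if "t \<in> A" for m t
    using neg[OF that, of m] d[OF that, of m] DERIV_unique by blast
  have dec: "G (b, t) < G (a, t)" if "t \<in> A" "a < b" for a b t
    using DERIV_neg_imp_decreasing[OF that(2), of "\<lambda>m. G (m, t)"] d d_neg that by blast
  have G_cont: "continuous_on (UNIV \<times> A) G"
    by (rule C1_on_imp_continuous_on[OF G])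
  have z_cont: "continuous_on A z"
    unfolding continuous_on_def
  proof (intro ballI tendstoI)
    fix t and \<epsilon> :: real assume t: "t \<in> A" and \<epsilon>: "\<epsilon> > 0"
    have lim: "((\<lambda>s. G (m, s)) \<longlongrightarrow> G (m, t)) (at t within A)" for m
    proof -
      have "continuous_on A (\<lambda>s. G (m, s))"
        by (rule continuous_on_compose2[OF G_cont]) (auto intro!: continuous_intros)
      then show ?thesis using t by (auto simp: continuous_on_def)
    qed
    \<comment> \<open>For \<open>s\<close> near \<open>t\<close> the strictly decreasing function
      \<open>G (_, s)\<close> keeps its signs at \<open>z t - \<epsilon>\<close> and
      \<open>z t + \<epsilon>\<close>, so its zero \<open>z s\<close> is trapped between
      them.\<close>
    have "eventually (\<lambda>s. G (z t - \<epsilon>, s) > 0) (at t within A)"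
      by (rule order_tendstoD[OF lim]) (use dec[OF t, of "z t - \<epsilon>" "z t"] zero[OF t] \<epsilon> in simp)
    moreover have "eventually (\<lambda>s. G (z t + \<epsilon>, s) < 0) (at t within A)"
      by (rule order_tendstoD[OF lim]) (use dec[OF t, of "z t" "z t + \<epsilon>"] zero[OF t] \<epsilon> in simp)
    moreover have "eventually (\<lambda>s. s \<in> A) (at t within A)"
      by (simp add: eventually_at_filter)
    ultimately show "eventually (\<lambda>s. dist (z s) (z t) < \<epsilon>) (at t within A)"
    proof eventually_elim
      case (elim s)
      have "z t - \<epsilon> < z s"
        using dec[OF elim(3), of "z s" "z t - \<epsilon>"] zero[OF elim(3)] elim(1)
        by (cases "z s" "z t - \<epsilon>" rule: linorder_cases) auto
      moreover have "z s < z t + \<epsilon>"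
        using dec[OF elim(3), of "z t + \<epsilon>" "z s"] zero[OF elim(3)] elim(2)
        by (cases "z s" "z t + \<epsilon>" rule: linorder_cases) auto
      ultimately show ?case by (auto simp: dist_real_def)
    qed
  qed
  have graph_cont: "continuous_on A (\<lambda>t. (z t, t))"
    by (intro continuous_intros z_cont)
  show ?thesis
  proof (rule C1_onI[where D = "\<lambda>t v. - e (z t, t) v / d (z t, t)"])
    fix i :: 'a
    show "continuous_on A (\<lambda>t. - e (z t, t) i / d (z t, t))"
      unfolding e_def d_def
      by (intro continuous_intros continuous_on_compose2[OF G'(3)[rule_format] graph_cont])
        (use d_neg in \<open>auto simp: d_def less_imp_neq\<close>)
  next
    fix t assume t: "t \<in> A"
    define p where "p = (z t, t)"
    define c where "c = - d p"
    have c: "c > 0" using d_neg[OF t] by (simp add: c_def p_def)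
    have e_bl: "bounded_linear (e p)"
      unfolding e_def by (intro bounded_linear_compose[OF blinfun.bounded_linear_right] bounded_linear_intros)
    then obtain K where K: "K > 0" "\<And>v. norm (e p v) \<le> norm v * K"
      using bounded_linear.pos_bounded by blast
    show "(z has_derivative (\<lambda>v. - e p v / d p)) (at t within A)"
      unfolding has_derivative_within_alt2
    proof (intro conjI allI impI)
      show "bounded_linear (\<lambda>v. - e p v / d p)"
        by (intro bounded_linear_divide[THEN bounded_linear_compose] bounded_linear_minus e_bl)
    next
      fix \<epsilon> :: real assume \<epsilon>: "\<epsilon> > 0"
      \<comment> \<open>With \<open>\<eta> \<le> c / 2\<close> the error term
        \<open>\<eta> * \<bar>a\<bar>\<close> is absorbed into \<open>c * \<bar>a\<bar>\<close>,
        leaving \<open>\<bar>a\<bar> \<le> M * n\<close>. The second entry of the minimum is what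
        makes the total error \<open>\<eta> * (M + 1) * n\<close> at most
        \<open>\<epsilon> * c * n\<close>.\<close>
      define M where "M = 2 * (K + c / 2) / c"
      define \<eta> where "\<eta> = min (c / 2) (\<epsilon> * c / (M + 1))"
      have M: "M > 0" using K c by (simp add: M_def)
      have \<eta>: "\<eta> > 0" "\<eta> \<le> c / 2"
        using c \<epsilon> M unfolding \<eta>_def by (simp, intro min.cobounded1)
      have "\<eta> \<le> \<epsilon> * c / (M + 1)"
        by (simp add: \<eta>_def)
      then have \<eta>M: "\<eta> * (M + 1) \<le> \<epsilon> * c"
        using M by (simp add: pos_le_divide_eq)
      have "eventually (\<lambda>q. norm (G q - G p - G' p (q - p)) \<le> \<eta> * norm (q - p))
          (at p within UNIV \<times> A)"
        using G'(1)[rule_format, of p] t \<eta>(1) unfolding has_derivative_within_alt2 by (auto simp: p_def)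
      \<comment> \<open>The estimate is trivial at \<open>p\<close> itself, so it extends from the
        punctured filter to \<open>nhds p\<close> and can be pulled back along the continuous graph
        of \<open>z\<close>.\<close>
      then have "eventually (\<lambda>q. q \<in> UNIV \<times> A \<longrightarrow>
          norm (G q - G p - G' p (q - p)) \<le> \<eta> * norm (q - p)) (nhds p)"
        by (simp add: eventually_at_filter) (auto elim!: eventually_mono simp: blinfun.zero_right)
      moreover have "((\<lambda>s. (z s, s)) \<longlongrightarrow> p) (at t within A)"
        using graph_cont t by (simp add: continuous_on_def p_def)
      ultimately have "eventually (\<lambda>s. (z s, s) \<in> UNIV \<times> A \<longrightarrow>
          norm (G (z s, s) - G p - G' p ((z s, s) - p)) \<le> \<eta> * norm ((z s, s) - p)) (at t within A)"
        by (rule eventually_compose_filterlim)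
      moreover have "eventually (\<lambda>s. s \<in> A) (at t within A)"
        by (simp add: eventually_at_filter)
      ultimately show "eventually (\<lambda>s. norm (z s - z t - - e p (s - t) / d p) \<le> \<epsilon> * norm (s - t))
          (at t within A)"
      proof eventually_elim
        case (elim s)
        define a where "a = z s - z t"
        define n where "n = norm (s - t)"
        \<comment> \<open>Both values of \<open>G\<close> on the graph vanish, so the linearisation
          error is the linear part alone.\<close>
        have "\<bar>- c * a + e p (s - t)\<bar> \<le> \<eta> * norm (a, s - t)"
          using elim zero[OF t] zero[OF elim(2)]
          by (simp add: p_def[symmetric] G'_eq a_def c_def)
            (simp add: p_def a_def G'_eq)
        also have "\<dots> \<le> \<eta> * (\<bar>a\<bar> + n)"
          using \<eta>(1) norm_Pair_le[of a "s - t"] by (simp add: n_def)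
        finally have 1: "\<bar>- c * a + e p (s - t)\<bar> \<le> \<eta> * (\<bar>a\<bar> + n)" .
        have n: "n \<ge> 0" by (simp add: n_def)
        have eK: "\<bar>e p (s - t)\<bar> \<le> n * K" using K(2)[of "s - t"] by (simp add: n_def)
        have "c * \<bar>a\<bar> = \<bar>c * a\<bar>" using c by (simp add: abs_mult)
        also have "\<dots> \<le> n * K + \<eta> * (\<bar>a\<bar> + n)" using 1 eK by linarith
        also have "\<dots> \<le> n * K + c / 2 * (\<bar>a\<bar> + n)"
          using \<eta>(2) n by (intro add_left_mono mult_right_mono) auto
        finally have "\<bar>a\<bar> \<le> M * n"
          using c by (simp add: M_def field_simps)
        then have "\<eta> * (\<bar>a\<bar> + n) \<le> \<eta> * (M + 1) * n"
          using \<eta>(1) by (simp add: algebra_simps)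
        also have "\<dots> \<le> \<epsilon> * c * n"
          by (rule mult_right_mono[OF \<eta>M n])
        finally have 2: "\<bar>- c * a + e p (s - t)\<bar> \<le> c * (\<epsilon> * n)"
          using 1 by (simp add: mult_ac)
        have "c * \<bar>a - e p (s - t) / c\<bar> = \<bar>- c * a + e p (s - t)\<bar>"
          using c by (subst abs_of_pos[OF c, symmetric], subst abs_mult[symmetric])
            (simp add: algebra_simps abs_minus_commute)
        with 2 have "\<bar>a - e p (s - t) / c\<bar> \<le> \<epsilon> * n"
          using c by (metis mult_le_cancel_left_pos)
        then show ?case
          by (simp add: a_def n_def c_def)
      qed
    qed
  qed
qed

subsection \<open>Growth bounds and minimisers\<close>

text \<open>A Gronwall argument started at the last time where \<open>\<sigma> \<le> 0\<close>.
  After it \<open>\<sigma>\<close> is positive, the bound reads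
  \<open>\<sigma>' \<le> C * \<sigma>\<close>, and \<open>exp (- C * r) * \<sigma> r\<close> cannot
  increase from a nonpositive to a positive value.\<close>

lemma nonpos_of_linear_growth_bound:
  fixes \<sigma> :: "real \<Rightarrow> real"
  assumes der: "\<And>t. t \<in> {0..T} \<Longrightarrow> (\<sigma> has_real_derivative \<sigma>' t) (at t within {0..T})"
    and bound: "\<And>t. t \<in> {0..T} \<Longrightarrow> \<sigma>' t \<le> C * \<bar>\<sigma> t\<bar>"
    and init: "\<sigma> 0 \<le> 0" and t: "t \<in> {0..T}"
  shows "\<sigma> t \<le> 0"
proof (rule ccontr)
  assume "\<not> \<sigma> t \<le> 0"
  then have pos: "\<sigma> t > 0" by simp
  have cont: "continuous_on {0..T} \<sigma>"
    using der by (meson DERIV_continuous continuous_on_eq_continuous_within)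
  \<comment> \<open>Closedness puts the supremum in \<open>N\<close>, so the last time with
    \<open>\<sigma> \<le> 0\<close> is attained.\<close>
  define N where "N = {0..t} \<inter> \<sigma> -` {..0}"
  have "closed N"
    unfolding N_def
    by (rule continuous_closed_preimage[OF continuous_on_subset[OF cont]]) (use t in auto)
  moreover have N: "0 \<in> N" "bdd_above N" using t init by (auto simp: N_def)
  ultimately have "Sup N \<in> N" by (auto intro: closed_contains_Sup)
  define s where "s = Sup N"
  have s: "0 \<le> s" "s \<le> t" "\<sigma> s \<le> 0" using \<open>Sup N \<in> N\<close> by (auto simp: N_def s_def)
  with pos have "s < t" by (cases "s = t") auto
  have after: "\<sigma> r > 0" if "s < r" "r \<le> t" for r
  proof (rule ccontr)
    assume "\<not> \<sigma> r > 0"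
    then have "r \<in> N" using that s by (auto simp: N_def)
    then have "r \<le> s" unfolding s_def using N(2) by (rule cSup_upper)
    with that show False by simp
  qed
  define \<omega> where "\<omega> r = exp (- C * r) * \<sigma> r" for r
  have der\<omega>: "(\<omega> has_real_derivative exp (- C * r) * (\<sigma>' r - C * \<sigma> r)) (at r within {s..t})"
    if "s \<le> r" "r \<le> t" for r
  proof -
    have "(\<sigma> has_real_derivative \<sigma>' r) (at r within {s..t})"
      by (rule DERIV_subset[OF der]) (use that s t in auto)
    then show ?thesis
      unfolding \<omega>_def by (auto intro!: derivative_eq_intros simp: algebra_simps)
  qed
  obtain r where r: "r \<in> {s<..<t}" "\<omega> t - \<omega> s = exp (- C * r) * (\<sigma>' r - C * \<sigma> r) * (t - s)"
    using mvt_simple[OF \<open>s < t\<close>, of \<omega> "\<lambda>r. (*) (exp (- C * r) * (\<sigma>' r - C * \<sigma> r))"] der\<omega>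
    unfolding has_field_derivative_def by auto
  have "\<sigma>' r - C * \<sigma> r \<le> 0"
    using bound[of r] after[of r] r(1) s t by auto
  then have "\<omega> t - \<omega> s \<le> 0"
    unfolding r(2) using \<open>s < t\<close> by (simp add: mult_nonneg_nonpos mult_nonpos_nonneg)
  moreover have "\<omega> s \<le> 0" using s by (simp add: \<omega>_def mult_nonneg_nonpos)
  moreover have "\<omega> t > 0" using pos by (simp add: \<omega>_def)
  ultimately show False by simp
qed

text \<open>If \<open>v \<bullet> a \<mu>\<close> stayed above \<open>c\<close>, a fixed competitor
  at level \<open>c - 1\<close> would save at least \<open>\<mu>\<close> in the linear term. Its
  extra cost in \<open>E\<close> is at most \<open>E u - E (a 0)\<close>, since \<open>a 0\<close>
  minimises \<open>E\<close>, so a large \<open>\<mu>\<close> contradicts minimality.\<close>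

lemma minimizers_inner_le:
  fixes E :: "'a::real_inner \<Rightarrow> real"
  assumes v: "v \<noteq> 0" and min: "\<And>\<mu> u. E (a \<mu>) + \<mu> * (v \<bullet> a \<mu>) \<le> E u + \<mu> * (v \<bullet> u)"
  shows "\<exists>\<mu>. v \<bullet> a \<mu> \<le> c"
proof (rule ccontr)
  assume "\<nexists>\<mu>. v \<bullet> a \<mu> \<le> c"
  then have above: "c \<le> v \<bullet> a \<mu>" for \<mu> by (meson linear)
  define u where "u = ((c - 1) / (v \<bullet> v)) *\<^sub>R v"
  have u: "v \<bullet> u = c - 1" using v by (simp add: u_def)
  define \<mu> where "\<mu> = \<bar>E u - E (a 0)\<bar> + 1"
  have "E (a 0) + \<mu> * c \<le> E (a \<mu>) + \<mu> * (v \<bullet> a \<mu>)"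
    using min[of 0 "a \<mu>"] above[of \<mu>] by (intro add_mono mult_left_mono) (auto simp: \<mu>_def)
  also have "\<dots> \<le> E u + \<mu> * (c - 1)" using min[of \<mu> u] u by simp
  finally have "\<mu> \<le> E u - E (a 0)" by (simp add: algebra_simps)
  then show False by (simp add: \<mu>_def)
qed

lemma minimizers_inner_surj:
  fixes E :: "'a::real_inner \<Rightarrow> real"
  assumes v: "v \<noteq> 0" and min: "\<And>\<mu> u. E (a \<mu>) + \<mu> * (v \<bullet> a \<mu>) \<le> E u + \<mu> * (v \<bullet> u)"
    and cont: "continuous_on UNIV a"
  shows "\<exists>\<mu>. v \<bullet> a \<mu> = c"
proof -
  obtain \<mu> where \<mu>: "v \<bullet> a \<mu> \<le> c" using minimizers_inner_le[OF v min] by blast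
  \<comment> \<open>Reversing the signs of \<open>v\<close> and of the multiplier preserves the
    minimisation property and gives a value on the other side of \<open>c\<close>; connectedness of
    the range does the rest.\<close>
  have "\<exists>\<nu>. - v \<bullet> a (- \<nu>) \<le> - c"
    by (rule minimizers_inner_le[where E = E]) (use v min[of "- \<nu>" for \<nu>] in auto)
  then obtain \<nu> where \<nu>: "c \<le> v \<bullet> a (- \<nu>)" by auto
  have "connected (range (\<lambda>\<mu>. v \<bullet> a \<mu>))"
    by (intro connected_continuous_image continuous_intros cont) auto
  then have "c \<in> range (\<lambda>\<mu>. v \<bullet> a \<mu>)"
    by (rule connectedD_interval[OF _ _ _ \<mu> \<nu>]) auto
  then show ?thesis by auto
qed

section \<open>Gradients, Hessians and stationary paths\<close>

lemma inner_grad: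
  fixes f :: "'a::euclidean_space \<Rightarrow> real"
  assumes D: "(f has_derivative D) (at x)"
  shows "grad f x \<bullet> w = D w"
proof -
  interpret D: bounded_linear D using D by (rule has_derivative_bounded_linear)
  \<comment> \<open>The Riesz vector of \<open>D\<close>. It is the only vector with the gradient
    property, so the definite description in \<open>grad\<close> denotes it.\<close>
  define d where "d = (\<Sum>b\<in>Basis. D b *\<^sub>R b)"
  have d: "D w = w \<bullet> d" for w
  proof -
    have "D w = D (\<Sum>b\<in>Basis. (w \<bullet> b) *\<^sub>R b)" by (simp add: euclidean_representation)
    also have "\<dots> = (\<Sum>b\<in>Basis. (w \<bullet> b) * D b)" by (simp add: D.sum D.scaleR)
    also have "\<dots> = w \<bullet> d" by (simp add: d_def inner_sum_right mult.commute)
    finally show ?thesis .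
  qed
  have "grad f x = d"
    unfolding grad_def
  proof (rule the_equality)
    have "D = (\<lambda>h. h \<bullet> d)" using d by (rule ext)
    then show "GDERIV f x :> d" using D by (simp add: gderiv_def)
  next
    fix d' assume "GDERIV f x :> d'"
    then have "(\<lambda>h. h \<bullet> d') = D" using D unfolding gderiv_def by (rule has_derivative_unique)
    then have "\<forall>w. w \<bullet> d' = w \<bullet> d" using d by (auto dest: fun_cong)
    then show "d' = d" by (simp add: vector_eq_ldot)
  qed
  then show ?thesis by (simp add: d inner_commute)
qed

text \<open>In this form the regularity of the derivative in the base point passes to
  \<open>grad\<close>, a fixed linear image of it.\<close>

lemma grad_eq_sum:
  fixes f :: "'a::euclidean_space \<Rightarrow> real"
  assumes "(f has_derivative D) (at x)"
  shows "grad f x = (\<Sum>b\<in>Basis. D b *\<^sub>R b)"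
  using euclidean_representation[of "grad f x"] by (simp add: inner_grad[OF assms])

lemma C2_on_grad_has_derivative:
  fixes E :: "real ^ 'm \<Rightarrow> real"
  assumes "C2_on UNIV E"
  shows "(grad E has_derivative (*v) (hessian E u)) (at u)"
proof -
  obtain E' where E': "\<forall>u\<in>UNIV. (E has_derivative blinfun_apply (E' u)) (at u)" "C1_on UNIV E'"
    using assms unfolding C2_on_def by blast
  have "grad E = (\<lambda>u. \<Sum>b\<in>Basis. blinfun_apply (E' u) b *\<^sub>R b)"
    using E'(1) by (auto intro!: grad_eq_sum)
  moreover have "C1_on UNIV (\<lambda>u. \<Sum>b\<in>Basis. blinfun_apply (E' u) b *\<^sub>R b)"
    by (intro C1_on_sum C1_on_bounded_linear_compose[OF _ E'(2)]
        bounded_linear_scaleR_left[THEN bounded_linear_compose] blinfun.bounded_linear_left)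
  ultimately have "C1_on UNIV (grad E)" by simp
  then have "grad E differentiable (at u)"
    by (rule C1_onE) (auto simp: differentiable_def)
  then show ?thesis by (simp add: jacobian_works hessian_def)
qed

text \<open>Differentiating the stationarity condition in \<open>m\<close> gives \<open>hessian E *v \<gamma>' = - v\<close>.\<close>

lemma stationary_path_inner_derivative_neg:
  fixes E :: "real ^ 'm \<Rightarrow> real"
  assumes E: "C2_on UNIV E" and pd: "pos_def (hessian E (\<gamma> \<mu>))"
    and stat: "\<And>m. grad E (\<gamma> m) + b + m *\<^sub>R v = 0"
    and \<gamma>: "(\<gamma> has_vector_derivative \<gamma>') (at \<mu>)" and v: "v \<noteq> 0"
  shows "v \<bullet> \<gamma>' < 0"
proof -
  let ?Q = "hessian E (\<gamma> \<mu>)"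
  have "((\<lambda>m. grad E (\<gamma> m)) has_derivative (\<lambda>h. ?Q *v (h *\<^sub>R \<gamma>'))) (at \<mu>)"
    using has_derivative_compose[OF \<gamma>[unfolded has_vector_derivative_def]
        C2_on_grad_has_derivative[OF E]] .
  moreover have "grad E (\<gamma> m) = - b - m *\<^sub>R v" for m
  proof -
    have "grad E (\<gamma> m) = (grad E (\<gamma> m) + b + m *\<^sub>R v) - b - m *\<^sub>R v" by simp
    then show ?thesis unfolding stat by simp
  qed
  ultimately have 1: "((\<lambda>m. - b - m *\<^sub>R v) has_derivative (\<lambda>h. ?Q *v (h *\<^sub>R \<gamma>'))) (at \<mu>)"
    by simp
  have 2: "((\<lambda>m. - b - m *\<^sub>R v) has_derivative (\<lambda>h. - (h *\<^sub>R v))) (at \<mu>)"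
    by (auto intro!: derivative_eq_intros)
  have "(\<lambda>h. ?Q *v (h *\<^sub>R \<gamma>')) = (\<lambda>h. - (h *\<^sub>R v))"
    using 1 2 by (rule has_derivative_unique)
  from fun_cong[OF this, of 1] have Q: "?Q *v \<gamma>' = - v" by simp
  \<comment> \<open>By \<open>Q\<close>, \<open>v \<bullet> \<gamma>'\<close> is minus the Hessian
    form at \<open>\<gamma>'\<close>, so it remains to exclude \<open>\<gamma>' = 0\<close>.\<close>
  then have "\<gamma>' \<noteq> 0" using v by auto
  then have "\<gamma>' \<bullet> (?Q *v \<gamma>') > 0" using pd by (simp add: pos_def_def)
  then show ?thesis by (simp add: Q inner_commute)
qed

subsection \<open>The weights \<open>phi1\<close> and \<open>phi2\<close>\<close>

text \<open>At 0 the argument of \<open>tanh\<close> is 1, and the prefactor of \<open>phi1\<close>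
  is exactly the reciprocal of \<open>1 + tanh 1\<close>.\<close>

lemma phi1_zero:
  assumes "rho1 > 0"
  shows "phi1 rho1 0 = 1"
proof -
  define e where "e = exp (1::real)"
  have e: "e > 0" "e\<^sup>2 > 0" by (auto simp: e_def)
  have "tanh (1::real) = (e - inverse e) / (e + inverse e)"
    by (simp add: tanh_altdef e_def exp_minus)
  also have "\<dots> = (e * (e - inverse e)) / (e * (e + inverse e))"
    using e by simp
  also have "\<dots> = (e\<^sup>2 - 1) / (e\<^sup>2 + 1)"
    using e by (simp add: algebra_simps power2_eq_square)
  finally have phi1: "phi1 rho1 0 = (e\<^sup>2 + 1) / (2 * e\<^sup>2) * (1 + (e\<^sup>2 - 1) / (e\<^sup>2 + 1))"
    using assms by (simp add: phi1_def e_def)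
  have "(a + 1) / (2 * a) * (1 + (a - 1) / (a + 1)) = 1" if "a > 0" for a :: real
  proof -
    have "a * 2 + a * (a * 2) > 0" using that by (simp add: add_pos_pos)
    then show ?thesis using that by (simp add: field_simps)
  qed
  from this[OF e(2)] show ?thesis unfolding phi1 .
qed

lemma phi1_DERIV:
  assumes "rho1 > 0"
  shows "(phi1 rho1 has_real_derivative
    ((exp 1)\<^sup>2 + 1) / (2 * (exp 1)\<^sup>2) * ((1 - (tanh ((s + rho1) / rho1))\<^sup>2) / rho1)) (at s)"
  unfolding phi1_def[abs_def]
  by (rule DERIV_cmult) (use assms in \<open>auto intro!: derivative_eq_intros\<close>)

lemma C1_on_phi1:
  assumes "rho1 > 0"
  shows "C1_on UNIV (phi1 rho1)"
  by (rule C1_on_DERIV[OF phi1_DERIV[OF assms]])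
    (use assms in \<open>auto intro!: continuous_intros simp: cosh_real_nonzero\<close>)

text \<open>The slope of \<open>phi1\<close> never exceeds \<open>1 / rho1\<close>. This linear
  modulus at 0 is the source of the growth bound in \<bar>S\<bar> behind feasibility.\<close>

lemma phi1_diff_le:
  assumes "rho1 > 0"
  shows "\<bar>phi1 rho1 s - 1\<bar> \<le> \<bar>s\<bar> / rho1"
proof -
  let ?d = "\<lambda>s. ((exp (1::real))\<^sup>2 + 1) / (2 * (exp 1)\<^sup>2) * ((1 - (tanh ((s + rho1) / rho1))\<^sup>2) / rho1)"
  have d: "norm (?d s) \<le> 1 / rho1" for s
  proof -
    have "tanh ((s + rho1) / rho1) ^ 2 \<le> 1"
      using tanh_real_bounds[of "(s + rho1) / rho1"] by (simp add: abs_square_le_1 abs_le_iff)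
    \<comment> \<open>This keeps the prefactor of \<open>phi1\<close> at most 1.\<close>
    moreover have "1 \<le> (exp (1::real))\<^sup>2" by (simp add: one_le_power)
    ultimately have "\<bar>?d s\<bar> \<le> 1 * (1 / rho1)"
      unfolding abs_mult using assms
      by (intro mult_mono) (auto simp: divide_simps abs_if)
    then show ?thesis by simp
  qed
  have "norm (phi1 rho1 s - phi1 rho1 0) \<le> 1 / rho1 * norm (s - 0)"
    by (rule field_differentiable_bound[OF convex_UNIV])
      (use phi1_DERIV[OF assms] d in auto)
  then show ?thesis using phi1_zero[OF assms] by simp
qed

text \<open>The argument of \<open>tanh\<close> is \<open>s / rho1 + 1\<close>, which tends to minus
  infinity for negative \<open>s\<close>.\<close>

lemma phi1_tendsto_0: "s < 0 \<Longrightarrow> ((\<lambda>rho1. phi1 rho1 s) \<longlongrightarrow> 0) (at_right 0)"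
proof -
  assume "s < 0"
  then have "filterlim (\<lambda>rho1. (s + rho1) / rho1) at_bot (at_right 0)" by real_asymp
  then have "((\<lambda>rho1. tanh ((s + rho1) / rho1)) \<longlongrightarrow> - 1) (at_right 0)"
    by (rule filterlim_compose[OF tanh_real_at_bot])
  then have "((\<lambda>rho1. phi1 rho1 s) \<longlongrightarrow> ((exp 1)\<^sup>2 + 1) / (2 * (exp 1)\<^sup>2) * (1 + - 1)) (at_right 0)"
    unfolding phi1_def by (intro tendsto_intros)
  then show ?thesis by simp
qed

text \<open>The classical flat function, whose smooth extension by zero accounts for the junction of
  \<open>phi2\<close> at -1.\<close>

definition flat :: "real \<Rightarrow> real \<Rightarrow> real" where
  "flat c y = (if y > 0 then exp (- c / y) else 0)"

lemma C1_on_flat: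
  assumes c: "c > 0"
  shows "C1_on UNIV (flat c)"
proof -
  define d where "d y = (if y > 0 then c / y\<^sup>2 * exp (- c / y) else 0)" for y
  have "(flat c has_real_derivative d y) (at y)" for y
  proof -
    consider "y > 0" | "y < 0" | "y = 0" by linarith
    then show ?thesis
    proof cases
      case 1
      have "((\<lambda>y. exp (- c / y)) has_real_derivative d y) (at y)"
        using 1 by (auto intro!: derivative_eq_intros simp: d_def power2_eq_square)
      then show ?thesis
        by (rule has_field_derivative_transform_within_open[where S = "{0<..}"])
          (use 1 in \<open>auto simp: flat_def\<close>)
    next
      case 2
      have "((\<lambda>y. 0) has_real_derivative d y) (at y)"
        using 2 by (simp add: d_def)
      then show ?thesis
        by (rule has_field_derivative_transform_within_open[where S = "{..<0}"])
          (use 2 in \<open>auto simp: flat_def\<close>)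
    next
      case 3
      \<comment> \<open>At the junction the exponential decay beats any power of \<open>h\<close>,
        so the right difference quotient vanishes like the left one.\<close>
      have "((\<lambda>h. exp (- c / h) / h) \<longlongrightarrow> 0) (at_right 0)"
        using c by real_asymp
      then have "((\<lambda>h. flat c h / h) \<longlongrightarrow> 0) (at_right 0)"
        by (rule tendsto_cong[THEN iffD1, rotated])
          (auto simp: flat_def eventually_at_filter)
      moreover have "((\<lambda>h. flat c h / h) \<longlongrightarrow> 0) (at_left 0)"
        by (rule tendsto_eventually) (auto simp: flat_def eventually_at_filter)
      ultimately have "((\<lambda>h. flat c h / h) \<longlongrightarrow> 0) (at 0)"
        by (simp add: filterlim_at_split)
      then show ?thesis by (simp add: 3 DERIV_def d_def flat_def)
    qed
  qed
  moreover have "continuous_on UNIV d"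
  proof -
    have "isCont d y" for y
    proof -
      consider "y > 0" | "y < 0" | "y = 0" by linarith
      then show ?thesis
      proof cases
        case 1
        have "isCont (\<lambda>y. c / y\<^sup>2 * exp (- c / y)) y"
          using 1 by (auto intro!: continuous_intros)
        then show ?thesis
          by (rule isCont_cong[THEN iffD1, OF eventually_mono[OF
                eventually_nhds_in_open[of "{0<..}" y]], rotated -1])
            (use 1 in \<open>auto simp: d_def\<close>)
      next
        case 2
        have "isCont (\<lambda>y. 0 :: real) y" by simp
        then show ?thesis
          by (rule isCont_cong[THEN iffD1, OF eventually_mono[OF
                eventually_nhds_in_open[of "{..<0}" y]], rotated -1])
            (use 2 in \<open>auto simp: d_def\<close>)
      next
        case 3
        have "((\<lambda>h. c / h\<^sup>2 * exp (- c / h)) \<longlongrightarrow> 0) (at_right 0)"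
          using c by real_asymp
        then have "(d \<longlongrightarrow> 0) (at_right 0)"
          by (rule tendsto_cong[THEN iffD1, rotated]) (auto simp: d_def eventually_at_filter)
        moreover have "(d \<longlongrightarrow> 0) (at_left 0)"
          by (rule tendsto_eventually) (auto simp: d_def eventually_at_filter)
        ultimately show ?thesis by (simp add: 3 isCont_def filterlim_at_split d_def)
      qed
    qed
    then show ?thesis by (simp add: continuous_at_imp_continuous_on)
  qed
  ultimately show ?thesis by (rule C1_on_DERIV)
qed

lemma C1_on_min_power2: "C1_on UNIV (\<lambda>s::real. (min s 0)\<^sup>2)"
proof (rule C1_on_DERIV[where f' = "\<lambda>s. 2 * min s 0"])
  fix s :: real
  consider "s > 0" | "s < 0" | "s = 0" by linarith
  then show "((\<lambda>s. (min s 0)\<^sup>2) has_real_derivative 2 * min s 0) (at s)"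
  proof cases
    case 1
    have "((\<lambda>s. 0) has_real_derivative 2 * min s 0) (at s)" using 1 by simp
    then show ?thesis
      by (rule has_field_derivative_transform_within_open[where S = "{0<..}"])
          (use 1 in \<open>auto\<close>)
  next
    case 2
    have "((\<lambda>s. s\<^sup>2) has_real_derivative 2 * min s 0) (at s)"
      using 2 by (auto intro!: derivative_eq_intros)
    then show ?thesis
      by (rule has_field_derivative_transform_within_open[where S = "{..<0}"])
          (use 2 in \<open>auto\<close>)
  next
    case 3
    have "((\<lambda>h::real. min h 0) \<longlongrightarrow> min 0 0) (at 0)" by (intro tendsto_intros)
    \<comment> \<open>The convention \<open>x / 0 = 0\<close> makes this hold at
      \<open>h = 0\<close> as well.\<close>
    moreover have "(min h 0)\<^sup>2 / h = min h 0" for h :: real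
      by (auto simp: min_def power2_eq_square)
    ultimately show ?thesis by (simp add: 3 DERIV_def)
  qed
qed (intro continuous_intros)

text \<open>Merges the three branches into one composite of C1 maps: truncating \<open>s\<close> at
  0 feeds 1 to \<open>flat\<close> on the right, where the two exponentials cancel, and
  \<open>1 - s^2 \<le> 0\<close> to it on the left. The difference is spelled as a sum with a
  product to fit the closure rules.\<close>

lemma phi2_eq_flat:
  assumes "rho2 > 0"
  shows "phi2 rho2 s = exp (1 / rho2\<^sup>2) * flat (1 / rho2\<^sup>2) (1 + - 1 * (min s 0)\<^sup>2)"
proof -
  consider "s > 0" | "s \<le> 0" "s > -1" | "s \<le> -1" by linarith
  then show ?thesis
  proof cases
    case 1
    then show ?thesis by (simp add: phi2_def flat_def flip: exp_add)
  next
    case 2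
    then have "s\<^sup>2 < 1" by (simp add: abs_square_less_1)
    with 2 assms show ?thesis
      by (simp add: phi2_def flat_def algebra_simps min_absorb1 flip: exp_add)
  next
    case 3
    then have "1 \<le> (- s)\<^sup>2" by (intro one_le_power) simp
    with 3 show ?thesis by (simp add: phi2_def flat_def min_absorb1)
  qed
qed

lemma C1_on_phi2:
  assumes "rho2 > 0"
  shows "C1_on UNIV (phi2 rho2)"
proof -
  have c: "1 / rho2\<^sup>2 > 0" using assms by simp
  have "C1_on UNIV (\<lambda>s::real. 1 + - 1 * (min s 0)\<^sup>2)"
    by (intro C1_on_add C1_on_mult C1_on_min_power2 C1_on_const)
  then have "C1_on UNIV (\<lambda>s. flat (1 / rho2\<^sup>2) (1 + - 1 * (min s 0)\<^sup>2))"
    by (rule C1_on_compose[OF _ C1_on_flat[OF c]]) simp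
  then show ?thesis
    unfolding phi2_eq_flat[OF assms, abs_def]
    by (intro C1_on_bounded_linear_compose[OF bounded_linear_mult_right])
qed

lemma phi2_nonneg: "0 \<le> phi2 rho2 s"
  by (simp add: phi2_def)

lemma phi2_eq_1: "0 \<le> s \<Longrightarrow> phi2 rho2 s = 1"
  by (cases "s = 0") (auto simp: phi2_def)

lemma phi2_exponent_neg:
  fixes s :: real
  assumes "-1 < s" "s < 0"
  shows "1 - 1 / (1 - s\<^sup>2) < 0"
proof -
  have "s\<^sup>2 < 1" "s\<^sup>2 > 0" using assms by (auto simp: abs_square_less_1)
  then show ?thesis by (simp add: field_simps)
qed

lemma phi2_le_1: "phi2 rho2 s \<le> 1"
proof (cases "s < 0 \<and> -1 < s")
  case True
  then show ?thesis
    using phi2_exponent_neg[of s]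
    by (auto simp: phi2_def divide_le_0_iff)
next
  case False
  then show ?thesis by (cases "s = 0") (auto simp: phi2_def)
qed

lemma phi2_tendsto_0:
  assumes "s < 0"
  shows "((\<lambda>rho2. phi2 rho2 s) \<longlongrightarrow> 0) (at_right 0)"
proof (cases "-1 < s")
  case True
  define q where "q = 1 - 1 / (1 - s\<^sup>2)"
  have "q < 0" using phi2_exponent_neg[OF True assms] by (simp add: q_def)
  then have "((\<lambda>rho2. exp (1 / rho2\<^sup>2 * q)) \<longlongrightarrow> 0) (at_right 0)" by real_asymp
  then show ?thesis using True assms by (simp add: phi2_def q_def)
qed (use assms in \<open>simp add: phi2_def\<close>)

subsection \<open>The control problem\<close>

text \<open>Nothing is assumed about \<open>h\<close>: its existence, uniqueness and regularity
  along C1 paths are derived. The equivalence in \<open>g_arg_min\<close> encodes both that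
  \<open>g\<close> minimises and that the minimiser is unique.\<close>

locale control_problem =
  fixes T :: real
    and f0 :: "real ^ 'n \<Rightarrow> real \<Rightarrow> real ^ 'n"
    and F :: "real ^ 'n \<Rightarrow> real \<Rightarrow> real ^ 'm ^ 'n"
    and S :: "real ^ 'n \<Rightarrow> real \<Rightarrow> real"
    and L :: "real ^ 'n \<Rightarrow> real ^ 'm \<Rightarrow> real \<Rightarrow> real"
    and g :: "real ^ 'n \<Rightarrow> real ^ 'n \<Rightarrow> real \<Rightarrow> real ^ 'm"
  assumes T_pos: "T > 0"
    and F_C2: "C2_on (UNIV \<times> {0..T}) (\<lambda>(x, t). F x t)"
    and S_C2: "C2_on (UNIV \<times> {0..T}) (\<lambda>(x, t). S x t)"
    and f0_diff: "twice_differentiable_on (\<lambda>(x, t). f0 x t) (UNIV \<times> {0..T})"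
    and first_order: "\<forall>x. \<forall>t\<in>{0..T}. S_x S x t v* F x t \<noteq> 0"
    and g_arg_min: "\<forall>x lam. \<forall>t\<in>{0..T}. \<forall>u.
           is_arg_min (\<lambda>v. H_o f0 F L x v lam t) (\<lambda>v. True) u \<longleftrightarrow> u = g x lam t"
    and g_C1: "C1_on (UNIV \<times> UNIV \<times> {0..T}) (\<lambda>(x, lam, t). g x lam t)"
    and L_C2: "\<forall>x. \<forall>t\<in>{0..T}. C2_on UNIV (\<lambda>u. L x u t)"
    and g_stationary: "\<forall>x lam. \<forall>t\<in>{0..T}. grad (\<lambda>u. L x u t) (g x lam t) + lam v* F x t = 0"
    and g_hessian: "\<forall>x lam. \<forall>t\<in>{0..T}. pos_def (hessian (\<lambda>u. L x u t) (g x lam t))"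
begin

section \<open>Partial derivatives of the state constraint\<close>

lemma S_derivatives:
  assumes S': "((\<lambda>(x, t). S x t) has_derivative S') (at (x, t) within UNIV \<times> {0..T})"
    and t: "t \<in> {0..T}"
  shows "S_x S x t = (\<Sum>b\<in>Basis. S' (b, 0) *\<^sub>R b)" (is ?x)
    and "S_t T S x t = S' (0, 1)" (is ?t)
    and "S' (v, r) = S_x S x t \<bullet> v + r * S_t T S x t" (is ?total)
proof -
  interpret S': bounded_linear S' using S' by (rule has_derivative_bounded_linear)
  have "((\<lambda>y. (y, t)) has_derivative (\<lambda>v. (v, 0))) (at x)"
    by (auto intro!: derivative_eq_intros)
  moreover have "((\<lambda>(x, t). S x t) has_derivative S') (at (x, t) within range (\<lambda>y. (y, t)))"
    by (rule has_derivative_subset[OF S']) (use t in auto)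
  ultimately have dx: "((\<lambda>y. S y t) has_derivative (\<lambda>v. S' (v, 0))) (at x)"
    using has_derivative_in_compose[of "\<lambda>y. (y, t)" "\<lambda>v. (v, 0)" x UNIV "\<lambda>(x, t). S x t" S'] by simp
  show ?x unfolding S_x_def by (rule grad_eq_sum[OF dx])
  have "((\<lambda>s. (x, s)) has_derivative (\<lambda>r. (0, r))) (at t within {0..T})"
    by (auto intro!: derivative_eq_intros)
  moreover have "((\<lambda>(x, t). S x t) has_derivative S') (at (x, t) within (\<lambda>s. (x, s)) ` {0..T})"
    by (rule has_derivative_subset[OF S']) auto
  ultimately have "((\<lambda>s. S x s) has_derivative (\<lambda>r. S' (0, r))) (at t within {0..T})"
    using has_derivative_in_compose[of "\<lambda>s. (x, s)" "\<lambda>r. (0, r)" t "{0..T}" "\<lambda>(x, t). S x t" S'] by simp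
  moreover have "(\<lambda>r. S' (0, r)) = (\<lambda>r. r *\<^sub>R S' (0, 1))"
  proof
    fix r show "S' (0, r) = r *\<^sub>R S' (0, 1)"
      using S'.scaleR[of r "(0, 1)"] by simp
  qed
  ultimately have dt: "((\<lambda>s. S x s) has_vector_derivative S' (0, 1)) (at t within {0..T})"
    unfolding has_vector_derivative_def by (simp only:)
  \<comment> \<open>Because \<open>T > 0\<close>, derivatives within the interval are unique even at
    its end points, so \<open>S_t\<close> takes the value of the joint derivative.\<close>
  show ?t unfolding S_t_def by (rule vector_derivative_within_closed_interval[OF T_pos t dt])
  have "S' (v, r) = S' (v, 0) + r *\<^sub>R S' (0, 1)"
    using S'.add[of "(v, 0)" "r *\<^sub>R (0, 1)"] S'.scaleR[of r "(0, 1)"] by simp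
  then show ?total using \<open>?t\<close> by (simp add: S_x_def inner_grad[OF dx])
qed

lemma C1_S_x: "C1_on (UNIV \<times> {0..T}) (\<lambda>(x, t). S_x S x t)"
  and C1_S_t: "C1_on (UNIV \<times> {0..T}) (\<lambda>(x, t). S_t T S x t)"
proof -
  obtain S' where S': "\<forall>p\<in>UNIV \<times> {0..T}.
      ((\<lambda>(x, t). S x t) has_derivative blinfun_apply (S' p)) (at p within UNIV \<times> {0..T})"
    "C1_on (UNIV \<times> {0..T}) S'"
    using S_C2 unfolding C2_on_def by blast
  have "C1_on (UNIV \<times> {0..T}) (\<lambda>p. \<Sum>b\<in>Basis. blinfun_apply (S' p) (b, 0) *\<^sub>R b)"
    by (intro C1_on_sum C1_on_bounded_linear_compose[OF _ S'(2)]
        bounded_linear_scaleR_left[THEN bounded_linear_compose] blinfun.bounded_linear_left)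
  then show "C1_on (UNIV \<times> {0..T}) (\<lambda>(x, t). S_x S x t)"
    by (rule C1_on_cong) (use S'(1) S_derivatives(1) in auto)
  have "C1_on (UNIV \<times> {0..T}) (\<lambda>p. blinfun_apply (S' p) (0, 1))"
    by (intro C1_on_bounded_linear_compose[OF _ S'(2)] blinfun.bounded_linear_left)
  then show "C1_on (UNIV \<times> {0..T}) (\<lambda>(x, t). S_t T S x t)"
    by (rule C1_on_cong) (use S'(1) S_derivatives(2) in auto)
qed

section \<open>The constraint rate as a function of the multiplier\<close>

lemma S1_eq: "S1 T f0 F S x u t = (S_x S x t \<bullet> f0 x t + S_t T S x t) + (S_x S x t v* F x t) \<bullet> u"
  by (simp add: S1_def dot_lmul_matrix)

lemma C1_g_along:
  fixes y l :: "'c::euclidean_space \<Rightarrow> real ^ 'n" and \<tau> :: "'c \<Rightarrow> real"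
  assumes "C1_on A y" "C1_on A l" "C1_on A \<tau>" "\<tau> ` A \<subseteq> {0..T}"
  shows "C1_on A (\<lambda>p. g (y p) (l p) (\<tau> p))"
  using C1_on_compose[OF C1_on_Pair[OF assms(1) C1_on_Pair[OF assms(2,3)]] g_C1] assms(4) by auto

lemma C1_g_line:
  assumes "t \<in> {0..T}"
  shows "C1_on UNIV (\<lambda>m. g x (lam + m *\<^sub>R w) t)"
  by (intro C1_g_along C1_on_add C1_on_const C1_on_scaleR C1_on_bounded_linear[OF bounded_linear_ident])
    (use assms in auto)

text \<open>One scalar function links the quantities of interest: its value at 0 is
  \<open>S1_o\<close>, its zero is \<open>h\<close>, and its value at \<open>mu_smooth\<close> is
  the rate under the smoothed control.\<close>

definition S1_at :: "real ^ 'n \<Rightarrow> real ^ 'n \<Rightarrow> real \<Rightarrow> real \<Rightarrow> real" where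
  "S1_at x lam t m = S1 T f0 F S x (g x (lam + m *\<^sub>R S_x S x t) t) t"

lemma S1_at_0: "S1_at x lam t 0 = S1_o T f0 F S g x lam t"
  by (simp add: S1_at_def S1_o_def)

lemma S1_at_DERIV_neg:
  assumes t: "t \<in> {0..T}"
  shows "\<exists>d<0. (S1_at x lam t has_real_derivative d) (at m)"
proof -
  let ?v = "S_x S x t v* F x t" and ?\<gamma> = "\<lambda>m. g x (lam + m *\<^sub>R S_x S x t) t"
  have "?\<gamma> differentiable (at m)"
    by (rule C1_onE[OF C1_g_line[OF t]]) (auto simp: differentiable_def)
  then obtain \<gamma>' where \<gamma>': "(?\<gamma> has_vector_derivative \<gamma>') (at m)"
    by (auto simp: vector_derivative_works)
  \<comment> \<open>Shifting the costate by \<open>m *\<^sub>R S_x S x t\<close> adds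
    \<open>m *\<^sub>R ?v\<close> to the stationarity condition, the shape required of a stationary
    path.\<close>
  have stat: "grad (\<lambda>u. L x u t) (?\<gamma> m) + lam v* F x t + m *\<^sub>R ?v = 0" for m
  proof -
    have "(lam + m *\<^sub>R S_x S x t) v* F x t = lam v* F x t + m *\<^sub>R ?v"
      by (simp add: matrix_vector_right_distrib matrix_vector_mult_scaleR flip: transpose_matrix_vector)
    then show ?thesis
      using g_stationary[rule_format, OF t, of x "lam + m *\<^sub>R S_x S x t"]
      by (simp add: add.assoc)
  qed
  have "?v \<bullet> \<gamma>' < 0"
    by (rule stationary_path_inner_derivative_neg[where E = "\<lambda>u. L x u t" and \<gamma> = ?\<gamma>,
          OF _ _ stat \<gamma>'])
      (use t L_C2 g_hessian first_order in auto)
  moreover have "(S1_at x lam t has_vector_derivative ?v \<bullet> \<gamma>') (at m)"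
    unfolding S1_at_def[abs_def] S1_eq
    using bounded_linear.has_vector_derivative[OF bounded_linear_inner_right \<gamma>', of ?v]
    by (auto intro!: derivative_eq_intros)
  ultimately show ?thesis
    by (auto simp: has_real_derivative_iff_has_vector_derivative)
qed

lemma S1_at_strict_decreasing:
  assumes "t \<in> {0..T}" "a < b"
  shows "S1_at x lam t b < S1_at x lam t a"
  using DERIV_neg_imp_decreasing[OF assms(2), of "S1_at x lam t"] S1_at_DERIV_neg[OF assms(1)] by blast

text \<open>Surjectivity along minimisers supplies a zero and strict monotonicity makes it unique,
  so the definite description in \<open>h\<close> denotes it.\<close>

lemma S1_at_h:
  assumes t: "t \<in> {0..T}"
  shows "S1_at x lam t (h T f0 F S g x lam t) = 0"
proof -
  let ?v = "S_x S x t v* F x t" and ?\<gamma> = "\<lambda>m. g x (lam + m *\<^sub>R S_x S x t) t"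
  let ?E = "\<lambda>u. L x u t + lam \<bullet> (F x t *v u)"
  \<comment> \<open>The terms of \<open>H_o\<close> containing \<open>f0\<close> do not depend on
    the control and cancel from the comparison.\<close>
  have "?E (?\<gamma> \<mu>) + \<mu> * (?v \<bullet> ?\<gamma> \<mu>) \<le> ?E u + \<mu> * (?v \<bullet> u)" for \<mu> u
  proof -
    have "is_arg_min (\<lambda>v. H_o f0 F L x v (lam + \<mu> *\<^sub>R S_x S x t) t) (\<lambda>v. True) (?\<gamma> \<mu>)"
      using g_arg_min t by blast
    then have "H_o f0 F L x (?\<gamma> \<mu>) (lam + \<mu> *\<^sub>R S_x S x t) t \<le> H_o f0 F L x u (lam + \<mu> *\<^sub>R S_x S x t) t"
      by (simp add: is_arg_min_def not_less)
    then show ?thesis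
      by (simp add: H_o_def inner_simps dot_lmul_matrix algebra_simps)
  qed
  then have "\<exists>m. ?v \<bullet> ?\<gamma> m = - (S_x S x t \<bullet> f0 x t + S_t T S x t)"
    by (intro minimizers_inner_surj[where E = ?E] C1_on_imp_continuous_on[OF C1_g_line[OF t]])
      (use first_order t in auto)
  then obtain m where "?v \<bullet> ?\<gamma> m = - (S_x S x t \<bullet> f0 x t + S_t T S x t)"
    by blast
  then have m: "S1_at x lam t m = 0"
    by (simp add: S1_at_def S1_eq)
  have "m' = m" if "S1_at x lam t m' = 0" for m'
    using S1_at_strict_decreasing[OF t, of m m' x lam] S1_at_strict_decreasing[OF t, of m' m x lam] m that
    by (cases m m' rule: linorder_cases) auto
  with m have "h T f0 F S g x lam t = m"
    unfolding h_def S1_at_def by (intro the_equality)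
  with m show ?thesis by simp
qed

lemma S1_at_nonpos:
  assumes "t \<in> {0..T}" "h T f0 F S g x lam t \<le> m"
  shows "S1_at x lam t m \<le> 0"
  using S1_at_strict_decreasing[OF assms(1), of "h T f0 F S g x lam t" m x lam] S1_at_h[OF assms(1), of x lam] assms(2)
  by (cases "h T f0 F S g x lam t = m") auto

text \<open>The rate is already negative at multiplier 0 and decreases in the multiplier, so its
  zero lies to the left of 0.\<close>

lemma h_neg:
  assumes "t \<in> {0..T}" "S1_o T f0 F S g x lam t < 0"
  shows "h T f0 F S g x lam t < 0"
  using S1_at_nonpos[OF assms(1)] S1_at_strict_decreasing[OF assms(1), of 0 "h T f0 F S g x lam t" x lam]
    S1_at_h[OF assms(1), of x lam] S1_at_0[of x lam t] assms(2)
  by (cases "h T f0 F S g x lam t" "0::real" rule: linorder_cases) auto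

lemma S1_at_h_phi2_nonpos:
  assumes t: "t \<in> {0..T}"
  shows "S1_at x lam t (h T f0 F S g x lam t * phi2 rho2 (S1_o T f0 F S g x lam t)) \<le> 0"
proof (rule S1_at_nonpos[OF t], cases "S1_o T f0 F S g x lam t < 0")
  case True
  then show "h T f0 F S g x lam t \<le> h T f0 F S g x lam t * phi2 rho2 (S1_o T f0 F S g x lam t)"
    using h_neg[OF t] phi2_le_1[of rho2] mult_left_mono_neg[of _ 1 "h T f0 F S g x lam t"] by fastforce
qed (simp add: phi2_eq_1)

section \<open>Regularity and feasibility along C1 paths\<close>

context
  fixes x lam :: "real \<Rightarrow> real ^ 'n"
  assumes x_C1: "C1_on {0..T} x" and lam_C1: "C1_on {0..T} lam"
begin

text \<open>Joint regularity in multiplier and time serves twice: for the implicit function argument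
  giving \<open>C1_h\<close>, and for the Lipschitz bound in \<open>feasible\<close>.\<close>

lemma C1_S1_at: "C1_on (UNIV \<times> {0..T}) (\<lambda>(m, t). S1_at (x t) (lam t) t m)"
proof -
  have snd: "C1_on (UNIV \<times> {0..T}) (snd :: real \<times> real \<Rightarrow> real)"
    and fst: "C1_on (UNIV \<times> {0..T}) (fst :: real \<times> real \<Rightarrow> real)"
    by (auto intro: C1_on_bounded_linear bounded_linear_fst bounded_linear_snd)
  have sub: "snd ` (UNIV \<times> {0..T}) \<subseteq> {0..T}" by auto
  note x = C1_on_compose[OF snd x_C1 sub] and lam = C1_on_compose[OF snd lam_C1 sub]
  note along = C1_on_along[OF _ x snd sub]
  have "C1_on (UNIV \<times> {0..T}) (\<lambda>p. S_x S (x (snd p)) (snd p) \<bullet> f0 (x (snd p)) (snd p)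
    + S_x S (x (snd p)) (snd p) \<bullet> (F (x (snd p)) (snd p) *v
        g (x (snd p)) (lam (snd p) + fst p *\<^sub>R S_x S (x (snd p)) (snd p)) (snd p))
    + S_t T S (x (snd p)) (snd p))"
    by (intro C1_on_add C1_on_inner C1_on_matrix_vector_mult C1_g_along C1_on_scaleR
        along[OF C1_S_x] along[OF C1_S_t] along[OF C2_on_imp_C1_on[OF F_C2]]
        along[OF twice_differentiable_on_imp_C1_on[OF f0_diff]] x lam fst snd sub)
  then show ?thesis
    by (simp add: S1_at_def S1_def case_prod_unfold)
qed

lemma C1_S1_o: "C1_on {0..T} (\<lambda>t. S1_o T f0 F S g (x t) (lam t) t)"
proof -
  have "C1_on {0..T} (\<lambda>t. (0 :: real, t))"
    by (intro C1_on_Pair C1_on_const C1_on_bounded_linear bounded_linear_ident)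
  from C1_on_compose[OF this C1_S1_at] show ?thesis by (auto simp: S1_at_0)
qed

lemma C1_h: "C1_on {0..T} (\<lambda>t. h T f0 F S g (x t) (lam t) t)"
  by (rule C1_on_implicit[OF C1_S1_at]) (use S1_at_DERIV_neg S1_at_h in auto)

lemma C1_h_phi2:
  assumes "rho2 > 0"
  shows "C1_on {0..T} (\<lambda>t. h T f0 F S g (x t) (lam t) t * phi2 rho2 (S1_o T f0 F S g (x t) (lam t) t))"
  by (intro C1_on_mult C1_h C1_on_compose[OF C1_S1_o C1_on_phi2[OF assms]]) simp

lemma C1_mu_smooth:
  assumes "rho1 > 0" "rho2 > 0"
  shows "C1_on {0..T} (\<lambda>t. mu_smooth T f0 F S g rho1 rho2 (x t) (lam t) t)"
proof -
  have "C1_on {0..T} (\<lambda>t. S (x t) t)"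
    by (rule C1_on_along[OF C2_on_imp_C1_on[OF S_C2] x_C1])
      (auto intro: C1_on_bounded_linear bounded_linear_ident)
  from C1_on_compose[OF this C1_on_phi1[OF assms(1)]]
  have "C1_on {0..T} (\<lambda>t. phi1 rho1 (S (x t) t) *
      (h T f0 F S g (x t) (lam t) t * phi2 rho2 (S1_o T f0 F S g (x t) (lam t) t)))"
    by (intro C1_on_mult C1_h_phi2[OF assms(2)]) simp
  then show ?thesis by (simp add: mu_smooth_def mult_ac)
qed

lemma feasible:
  assumes rho: "rho1 > 0" "rho2 > 0" and init: "S (x 0) 0 \<le> 0"
    and ode: "\<And>t. t \<in> {0..T} \<Longrightarrow> (x has_vector_derivative f0 (x t) t + F (x t) t *v
        u_smooth T f0 F S g rho1 rho2 (x t) (lam t) t) (at t within {0..T})"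
    and t: "t \<in> {0..T}"
  shows "S (x t) t \<le> 0"
proof -
  define \<mu> where "\<mu> t = mu_smooth T f0 F S g rho1 rho2 (x t) (lam t) t" for t
  \<comment> \<open>The comparison multiplier: \<open>\<mu>\<close> with \<open>phi1\<close>
    replaced by its value 1 on the constraint boundary. Its rate is nonpositive at every
    time.\<close>
  define \<mu>0 where "\<mu>0 t = h T f0 F S g (x t) (lam t) t * phi2 rho2 (S1_o T f0 F S g (x t) (lam t) t)" for t
  have "continuous_on {0..T} \<mu>" "continuous_on {0..T} \<mu>0"
    using C1_mu_smooth[OF rho] C1_h_phi2[OF rho(2)]
    by (auto simp: \<mu>_def[abs_def] \<mu>0_def[abs_def] intro: C1_on_imp_continuous_on)
  \<comment> \<open>A common bound for both multipliers confines them to a compact convex box, on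
    which the rate is Lipschitz.\<close>
  then have "bounded (\<mu> ` {0..T} \<union> \<mu>0 ` {0..T})"
    by (auto intro!: compact_imp_bounded compact_continuous_image)
  then obtain M where M: "M > 0" "\<And>t. t \<in> {0..T} \<Longrightarrow> \<bar>\<mu> t\<bar> \<le> M \<and> \<bar>\<mu>0 t\<bar> \<le> M"
    by (force simp: bounded_pos)
  obtain K where K: "K \<ge> 0" "\<And>p q. p \<in> {-M..M} \<times> {0..T} \<Longrightarrow> q \<in> {-M..M} \<times> {0..T} \<Longrightarrow>
      norm ((\<lambda>(m, t). S1_at (x t) (lam t) t m) p - (\<lambda>(m, t). S1_at (x t) (lam t) t m) q) \<le> K * norm (p - q)"
    by (rule C1_on_lipschitz[OF C1_S1_at, of "{-M..M} \<times> {0..T}"])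
      (auto intro: compact_Times convex_Times)
  show ?thesis
  proof (rule nonpos_of_linear_growth_bound[where \<sigma> = "\<lambda>t. S (x t) t" and C = "K * (M / rho1)"
        and \<sigma>' = "\<lambda>t. S1_at (x t) (lam t) t (\<mu> t)", OF _ _ init t])
    fix t assume t: "t \<in> {0..T}"
    let ?x' = "f0 (x t) t + F (x t) t *v u_smooth T f0 F S g rho1 rho2 (x t) (lam t) t"
    obtain S' where S': "((\<lambda>(x, t). S x t) has_derivative S') (at (x t, t) within UNIV \<times> {0..T})"
      using S_C2 t unfolding C2_on_def by blast
    have "((\<lambda>t. (x t, t)) has_derivative (\<lambda>r. (r *\<^sub>R ?x', r))) (at t within {0..T})"
      using ode[OF t] by (auto simp: has_vector_derivative_def intro!: has_derivative_Pair)
    moreover have "((\<lambda>(x, t). S x t) has_derivative S') (at (x t, t) within (\<lambda>t. (x t, t)) ` {0..T})"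
      by (rule has_derivative_subset[OF S']) auto
    ultimately have "((\<lambda>t. S (x t) t) has_derivative (\<lambda>r. S' (r *\<^sub>R ?x', r))) (at t within {0..T})"
      using has_derivative_in_compose[of "\<lambda>t. (x t, t)" "\<lambda>r. (r *\<^sub>R ?x', r)" t "{0..T}" "\<lambda>(x, t). S x t" S']
      by simp
    \<comment> \<open>Substituting the state equation into the total derivative of \<open>S\<close>
      turns it into the rate at the smoothed multiplier.\<close>
    moreover have "S' (r *\<^sub>R ?x', r) = S1_at (x t) (lam t) t (\<mu> t) * r" for r
      by (simp add: S_derivatives(3)[OF S' t] S1_at_def S1_def u_smooth_def \<mu>_def algebra_simps inner_simps)
    ultimately show "((\<lambda>t. S (x t) t) has_real_derivative S1_at (x t) (lam t) t (\<mu> t)) (at t within {0..T})"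
      by (simp add: has_field_derivative_def)
    \<comment> \<open>The multipliers differ only through \<open>phi1 - 1\<close>, which is of order
      \<open>\<bar>S\<bar> / rho1\<close>; the Lipschitz constant carries this over to the
      rates.\<close>
    have "\<mu> t - \<mu>0 t = \<mu>0 t * (phi1 rho1 (S (x t) t) - 1)"
      by (simp add: \<mu>_def \<mu>0_def mu_smooth_def algebra_simps)
    then have "\<bar>\<mu> t - \<mu>0 t\<bar> = \<bar>\<mu>0 t\<bar> * \<bar>phi1 rho1 (S (x t) t) - 1\<bar>"
      by (simp add: abs_mult)
    also have "\<dots> \<le> M * (\<bar>S (x t) t\<bar> / rho1)"
      using M(1) M(2)[OF t] phi1_diff_le[OF rho(1)] by (intro mult_mono) auto
    finally have "K * \<bar>\<mu> t - \<mu>0 t\<bar> \<le> K * (M * (\<bar>S (x t) t\<bar> / rho1))"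
      using K(1) by (rule mult_left_mono)
    moreover have "S1_at (x t) (lam t) t (\<mu> t) - S1_at (x t) (lam t) t (\<mu>0 t) \<le> K * \<bar>\<mu> t - \<mu>0 t\<bar>"
      using K(2)[of "(\<mu> t, t)" "(\<mu>0 t, t)"] M(2)[OF t] t by (auto simp: abs_le_iff norm_Pair)
    moreover have "S1_at (x t) (lam t) t (\<mu>0 t) \<le> 0"
      unfolding \<mu>0_def by (rule S1_at_h_phi2_nonpos[OF t])
    ultimately show "S1_at (x t) (lam t) t (\<mu> t) \<le> K * (M / rho1) * \<bar>S (x t) t\<bar>"
      by simp
  qed
qed

end

text \<open>The product filter lets both parameters vanish jointly, with no relation between them.
  Off the constraint \<open>phi1\<close> forces the limit 0; on it \<open>phi1\<close> is 1 and
  \<open>phi2\<close> selects by the sign of \<open>S1_o\<close>.\<close>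

lemma mu_smooth_tendsto_mu_star:
  assumes t: "t \<in> {0..T}" and feas: "S x t \<le> 0"
  shows "((\<lambda>(rho1, rho2). mu_smooth T f0 F S g rho1 rho2 x lam t)
           \<longlongrightarrow> mu_star T f0 F S g x lam t) (at_right 0 \<times>\<^sub>F at_right 0)"
proof -
  define c where "c = h T f0 F S g x lam t"
  define o1 where "o1 = S1_o T f0 F S g x lam t"
  let ?\<F> = "at_right (0::real) \<times>\<^sub>F at_right (0::real)"
  have eq: "(\<lambda>(rho1, rho2). mu_smooth T f0 F S g rho1 rho2 x lam t) =
      (\<lambda>p. c * phi1 (fst p) (S x t) * phi2 (snd p) o1)"
    by (auto simp: mu_smooth_def c_def o1_def)
  have "eventually (\<lambda>p. fst p > 0) ?\<F>"
    by (rule eventually_compose_filterlim[OF eventually_at_right_less filterlim_fst])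
  then have phi1: "eventually (\<lambda>p. phi1 (fst p) 0 = 1) ?\<F>"
    by (rule eventually_mono) (rule phi1_zero)
  consider "S x t < 0" | "S x t = 0" "o1 \<ge> 0" | "S x t = 0" "o1 < 0"
    using feas by linarith
  then show ?thesis
  proof cases
    case 1
    have "((\<lambda>p. phi1 (fst p) (S x t)) \<longlongrightarrow> 0) ?\<F>"
      by (rule filterlim_compose[OF phi1_tendsto_0[OF 1] filterlim_fst])
    then have "((\<lambda>p. \<bar>c\<bar> * \<bar>phi1 (fst p) (S x t)\<bar>) \<longlongrightarrow> 0) ?\<F>"
      by (intro tendsto_mult_right_zero tendsto_rabs_zero)
    \<comment> \<open>Since \<open>phi2\<close> stays between 0 and 1, a squeeze works whatever the
      sign of \<open>o1\<close>.\<close>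
    then have "((\<lambda>p. c * phi1 (fst p) (S x t) * phi2 (snd p) o1) \<longlongrightarrow> 0) ?\<F>"
      by (rule Lim_null_comparison[rotated])
        (auto simp: abs_mult phi2_nonneg phi2_le_1 mult_left_le)
    with 1 show ?thesis by (simp add: eq mu_star_def)
  next
    case 2
    have "((\<lambda>p. c * phi1 (fst p) (S x t) * phi2 (snd p) o1) \<longlongrightarrow> c) ?\<F>"
      by (rule tendsto_eventually, rule eventually_mono[OF phi1]) (use 2 in \<open>simp add: phi2_eq_1\<close>)
    with 2 show ?thesis by (simp add: eq mu_star_def c_def o1_def)
  next
    case 3
    have "((\<lambda>p. c * phi2 (snd p) o1) \<longlongrightarrow> 0) ?\<F>"
      by (intro tendsto_mult_right_zero filterlim_compose[OF phi2_tendsto_0[OF 3(2)] filterlim_snd])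
    then have "((\<lambda>p. c * phi1 (fst p) (S x t) * phi2 (snd p) o1) \<longlongrightarrow> 0) ?\<F>"
      by (rule tendsto_cong[THEN iffD1, rotated], intro eventually_mono[OF phi1]) (use 3 in simp)
    with 3 show ?thesis by (simp add: eq mu_star_def o1_def)
  qed
qed

end

theorem lemma2:
  fixes T :: real
    and f0 :: "real ^ 'n \<Rightarrow> real \<Rightarrow> real ^ 'n"
    and F :: "real ^ 'n \<Rightarrow> real \<Rightarrow> real ^ 'm ^ 'n"
    and S :: "real ^ 'n \<Rightarrow> real \<Rightarrow> real"
    and L :: "real ^ 'n \<Rightarrow> real ^ 'm \<Rightarrow> real \<Rightarrow> real"
    and g :: "real ^ 'n \<Rightarrow> real ^ 'n \<Rightarrow> real \<Rightarrow> real ^ 'm"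
    and BC :: "real ^ 'n \<Rightarrow> real ^ 'n \<Rightarrow> real ^ 'n \<Rightarrow> real ^ 'n \<Rightarrow> bool"
  assumes "T > 0"
    and "C2_on (UNIV \<times> {0..T}) (\<lambda>(x, t). F x t)"
    and "C2_on (UNIV \<times> {0..T}) (\<lambda>(x, t). S x t)"
    and "twice_differentiable_on (\<lambda>(x, t). f0 x t) (UNIV \<times> {0..T})"
    and "\<forall>x. \<forall>t\<in>{0..T}. S_x S x t v* F x t \<noteq> 0"
    and "\<forall>x lam. \<forall>t\<in>{0..T}. \<forall>u.
           is_arg_min (\<lambda>v. H_o f0 F L x v lam t) (\<lambda>v. True) u \<longleftrightarrow> u = g x lam t"
    and "C1_on (UNIV \<times> UNIV \<times> {0..T}) (\<lambda>(x, lam, t). g x lam t)"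
    and "\<forall>x. \<forall>t\<in>{0..T}. C2_on UNIV (\<lambda>u. L x u t)"
    and "\<forall>x lam. \<forall>t\<in>{0..T}. grad (\<lambda>u. L x u t) (g x lam t) + lam v* F x t = 0"
    and "\<forall>x lam. \<forall>t\<in>{0..T}. pos_def (hessian (\<lambda>u. L x u t) (g x lam t))"
  shows
    "(\<forall>rho1>0. \<forall>rho2>0. \<forall>rho3>0. \<forall>x lam.
        smoothed_optimal_trajectory BC T f0 F S L g rho1 rho2 rho3 x lam \<longrightarrow>
        C1_on {0..T} (\<lambda>t. mu_smooth T f0 F S g rho1 rho2 (x t) (lam t) t)) \<and>
     (\<forall>rho1>0. \<forall>rho2>0. \<forall>rho3>0. \<forall>x lam.
        smoothed_trajectory T f0 F S L g rho1 rho2 rho3 x lam \<and> S (x 0) 0 \<le> 0 \<longrightarrow>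
        (\<forall>t\<in>{0..T}. S (x t) t \<le> 0)) \<and>
     (\<forall>x lam. \<forall>t\<in>{0..T}. S x t \<le> 0 \<longrightarrow>
        ((\<lambda>(rho1, rho2). mu_smooth T f0 F S g rho1 rho2 x lam t)
           \<longlongrightarrow> mu_star T f0 F S g x lam t) (at_right 0 \<times>\<^sub>F at_right 0))"
proof -
  interpret control_problem T f0 F S L g
    by unfold_locales (fact assms)+
  have "C1_on {0..T} (\<lambda>t. mu_smooth T f0 F S g rho1 rho2 (x t) (lam t) t)"
    if "rho1 > 0" "rho2 > 0" "smoothed_optimal_trajectory BC T f0 F S L g rho1 rho2 rho3 x lam"
    for rho1 rho2 rho3 x lam
    using that by (intro C1_mu_smooth)
      (auto simp: smoothed_optimal_trajectory_def smoothed_trajectory_def)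
  moreover have "S (x t) t \<le> 0"
    if rho: "rho1 > 0" "rho2 > 0" and traj: "smoothed_trajectory T f0 F S L g rho1 rho2 rho3 x lam"
      and init: "S (x 0) 0 \<le> 0" and t: "t \<in> {0..T}"
    for rho1 rho2 rho3 x lam t
  proof (rule feasible[where x = x and lam = lam, OF _ _ rho init _ t])
    show "C1_on {0..T} x" "C1_on {0..T} lam"
      using traj by (simp_all add: smoothed_trajectory_def)
    show "(x has_vector_derivative f0 (x t) t + F (x t) t *v
        u_smooth T f0 F S g rho1 rho2 (x t) (lam t) t) (at t within {0..T})"
      if "t \<in> {0..T}" for t
      using traj that by (simp add: smoothed_trajectory_def Let_def)
  qed
  ultimately show ?thesis
    using mu_smooth_tendsto_mu_star by blast
qed

end
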